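(* Let $(A,\cdot)$ be an anti-Leibniz algebra. (1) Let $r\in A\otimes A$ and $\lambda\in\Bbbk$, put $\mathcal{I}=r^{\sharp}-\tau(r)^{\sharp}$ and suppose that $(A,\cdot,\Delta_r)$ is an anti-Leibniz bialgebra induced by $r$ which is factorizable. Define $\mathfrak{B}_{\mathcal{I}}(a_1,a_2)=\langle\mathcal{I}^{-1}(a_1),a_2\rangle$ for $a_1,a_2\in A$. Then $(A,\cdot,\mathfrak{B}_{\mathcal{I}},R)$ with $R=\lambda\,\tau(r)^{\sharp}\mathcal{I}^{-1}$ is a skew-quadratic Rota–Baxter anti-Leibniz algebra of weight $\lambda$. (2) Conversely, let $(A,\cdot,\mathfrak{B},R)$ be a skew-quadratic Rota–Baxter anti-Leibniz algebra of weight $\lambda$, and let $\mathcal{I}_{\mathfrak{B}}:A^{*}\to A$ be the linear isomorphism given by $\langle\mathcal{I}_{\mathfrak{B}}^{-1}(a_1),a_2\rangle=\mathfrak{B}(a_1,a_2)$ for $a_1,a_2\in A$. If $\lambda\neq0$, define $$r^{\sharp}:=\tfrac{1}{\lambda}(R+\lambda\,\mathrm{id})\mathcal{I}_{\mathfrak{B}}:A^{*}\to A$$ and define $r\in A\otimes A$ by $\langle r^{\sharp}(\xi_1),\xi_2\rangle=\langle r,\xi_1\otimes\xi_2\rangle$ for $\xi_1,\xi_2\in A^{*}$. Then $r$ is a solution of the anti-Leibniz Yang–Baxter equation in $(A,\cdot)$ and gives rise to a factorizable anti-Leibniz bialgebra $(A,\cdot,\Delta_r)$.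
   Context: $\Bbbk$ is a field of characteristic zero; all vector spaces and algebras are finite-dimensional over $\Bbbk$. $\tau(a\otimes b)=b\otimes a$. An anti-Leibniz algebra $(A,\cdot)$ is a vector space with a bilinear product such that $a_1(a_2a_3)+(a_1a_2)a_3+a_2(a_1a_3)=0$. $\mathbf{l}_A(a)(b)=ab$, $\mathbf{r}_A(a)(b)=ba$. For $r=\sum_i x_i\otimes y_i\in A\otimes A$: $r^{\sharp}:A^{*}\to A$ is defined by $\langle r^{\sharp}(\xi_1),\xi_2\rangle=\langle\xi_1\otimes\xi_2,r\rangle$, i.e. $r^{\sharp}(\xi)=\sum_i\langle\xi,x_i\rangle y_i$. $r$ is a solution of the anti-Leibniz Yang–Baxter equation if $\sum_{i,j}\big(x_ix_j\otimes y_i\otimes y_j+x_i\otimes y_ix_j\otimes y_j-x_j\otimes x_iy_j\otimes y_i-x_j\otimes x_i\otimes y_iy_j\big)=0$. An element $s\in A\otimes A$ is invariant if $((\mathbf{r}_A-\mathbf{l}_A)(a)\otimes\mathrm{id}+\mathrm{id}\otimes\mathbf{r}_A(a))(s)=0$ for all $a\in A$. Put $\Delta_r(a)=((\mathbf{r}_A-\mathbf{l}_A)(a)\otimes\mathrm{id}+\mathrm{id}\otimes\mathbf{r}_A(a))(r)$. An anti-Leibniz bialgebra is a triple $(A,\cdot,\Delta)$, $(A,\cdot)$ an anti-Leibniz algebra, $\Delta:A\to A\otimes A$ linear with $(\Delta\otimes\mathrm{id})\Delta+(\mathrm{id}\otimes\Delta)\Delta+(\tau\otimes\mathrm{id})(\mathrm{id}\otimes\Delta)\Delta=0$,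 and for all $a_1,a_2\in A$: $\Delta(a_1a_2)+\big((\mathrm{id}\otimes\mathbf{r}_A(a_2)-\mathbf{r}_A(a_2)\otimes\mathrm{id}+\mathbf{l}_A(a_2)\otimes\mathrm{id})(\mathrm{id}\otimes\mathrm{id}-\tau)\big)\Delta(a_1)+(\mathrm{id}\otimes\mathbf{l}_A(a_1)+\mathbf{l}_A(a_1)\otimes\mathrm{id})\Delta(a_2)=0$, $(\mathbf{r}_A(a_1)\otimes\mathrm{id})\Delta(a_2)-\tau\big((\mathbf{r}_A(a_2)\otimes\mathrm{id})\Delta(a_1)\big)=0$. If $r$ is a solution of the anti-Leibniz Yang–Baxter equation and $r-\tau(r)$ is invariant, then $(A,\cdot,\Delta_r)$ is an anti-Leibniz bialgebra, called quasi-triangular; it is factorizable if moreover $r^{\sharp}-\tau(r)^{\sharp}:A^{*}\to A$ is a linear isomorphism. A bilinear form $\mathfrak{B}$ on $(A,\cdot)$ is skew-symmetric if $\mathfrak{B}(a_1,a_2)=-\mathfrak{B}(a_2,a_1)$ and invariant if $\mathfrak{B}(a_1a_2,a_3)=\mathfrak{B}(a_1,a_2a_3-a_3a_2)$. A Rota–Baxter operator of weight $\lambda\in\Bbbk$ on $(A,\cdot)$ is a linear map $R:A\to A$ with $R(a_1)R(a_2)=R\big(R(a_1)a_2+a_1R(a_2)+\lambda a_1a_2\big)$. A skew-quadratic Rota–Baxter anti-Leibniz algebra of weight $\lambda$ is $(A,\cdot,\mathfrak{B},R)$ with $\mathfrak{B}$ a nondegenerate skew-symmetric invariant bilinear form and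 $R$ a Rota–Baxter operator of weight $\lambda$ satisfying $\mathfrak{B}(R(a_1),a_2)+\mathfrak{B}(a_1,R(a_2))+\lambda\mathfrak{B}(a_1,a_2)=0$ for all $a_1,a_2\in A$. *)

theory Defs
  imports Complex_Main "HOL-Library.Function_Algebras"
begin

section \<open>Dual space and tensor powers\<close>

text \<open>
  A vector space is a type \<open>'a\<close> with a scalar multiplication \<open>s\<close> as in the locale
  \<^locale>\<open>vector_space\<close>. Its dual is the set of linear functionals, and for \<open>A\<close> finite-dimensional
  \<open>A \<otimes> A\<close> and \<open>A \<otimes> A \<otimes> A\<close> are realised as spaces of multilinear forms on the dual:
  \<open>x \<otimes> y\<close> is the form \<open>(\<xi>, \<eta>) \<mapsto> \<xi> x * \<eta> y\<close>. Hence the pairing \<open>\<langle>\<xi> \<otimes> \<eta>, t\<rangle>\<close> is simply \<open>t \<xi> \<eta>\<close>.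
  Forms are set to \<open>0\<close> as soon as an argument is not a linear functional, so that equality of
  tensors is equality of functions. The universal property is proved below
  (\<open>tensor_square_universal\<close>).
\<close>

type_synonym ('k, 'a) tens2 = "('a \<Rightarrow> 'k) \<Rightarrow> ('a \<Rightarrow> 'k) \<Rightarrow> 'k"
type_synonym ('k, 'a) tens3 = "('a \<Rightarrow> 'k) \<Rightarrow> ('a \<Rightarrow> 'k) \<Rightarrow> ('a \<Rightarrow> 'k) \<Rightarrow> 'k"

definition dual_space :: "('k::field \<Rightarrow> 'a::ab_group_add \<Rightarrow> 'a) \<Rightarrow> ('a \<Rightarrow> 'k) set" where
  "dual_space s = {\<xi>. Vector_Spaces.linear s (*) \<xi>}"

definition restrict2 ::
  "('k::field \<Rightarrow> 'a::ab_group_add \<Rightarrow> 'a) \<Rightarrow> ('k, 'a) tens2 \<Rightarrow> ('k, 'a) tens2" where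
  "restrict2 s F = (\<lambda>\<xi> \<eta>. if \<xi> \<in> dual_space s \<and> \<eta> \<in> dual_space s then F \<xi> \<eta> else 0)"

definition restrict3 ::
  "('k::field \<Rightarrow> 'a::ab_group_add \<Rightarrow> 'a) \<Rightarrow> ('k, 'a) tens3 \<Rightarrow> ('k, 'a) tens3" where
  "restrict3 s F = (\<lambda>\<xi> \<eta> \<zeta>.
     if \<xi> \<in> dual_space s \<and> \<eta> \<in> dual_space s \<and> \<zeta> \<in> dual_space s then F \<xi> \<eta> \<zeta> else 0)"

definition tensor2 ::
  "('k::field \<Rightarrow> 'a::ab_group_add \<Rightarrow> 'a) \<Rightarrow> 'a \<Rightarrow> 'a \<Rightarrow> ('k, 'a) tens2" where
  "tensor2 s x y = restrict2 s (\<lambda>\<xi> \<eta>. \<xi> x * \<eta> y)"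

definition tensor3 ::
  "('k::field \<Rightarrow> 'a::ab_group_add \<Rightarrow> 'a) \<Rightarrow> 'a \<Rightarrow> 'a \<Rightarrow> 'a \<Rightarrow> ('k, 'a) tens3" where
  "tensor3 s x y z = restrict3 s (\<lambda>\<xi> \<eta> \<zeta>. \<xi> x * \<eta> y * \<zeta> z)"

definition tensor_square ::
  "('k::field \<Rightarrow> 'a::ab_group_add \<Rightarrow> 'a) \<Rightarrow> ('k, 'a) tens2 set" where
  "tensor_square s = {t. \<exists>xs. t = (\<Sum>(x, y)\<leftarrow>xs. tensor2 s x y)}"

definition tens2_scale :: "'k::field \<Rightarrow> ('k, 'a) tens2 \<Rightarrow> ('k, 'a) tens2" where
  "tens2_scale c t = (\<lambda>\<xi> \<eta>. c * t \<xi> \<eta>)"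

text \<open>
  Induced maps, written through their transposes: \<open>f \<otimes> g\<close>, the flips \<open>\<tau>\<close> and \<open>\<tau> \<otimes> id\<close>, and
  \<open>\<Delta> \<otimes> id\<close>, \<open>id \<otimes> \<Delta>\<close> for \<open>\<Delta> : A \<rightarrow> A \<otimes> A\<close>. The lemmas \<open>tensor_map_tensor2\<close>, \<open>flip2_tensor2\<close>,
  \<open>flip12_tensor3\<close>, \<open>comult_id_tensor2\<close> and \<open>id_comult_tensor2\<close> give the values on elementary tensors.
\<close>

definition tensor_map ::
  "('k::field \<Rightarrow> 'a::ab_group_add \<Rightarrow> 'a) \<Rightarrow> ('a \<Rightarrow> 'a) \<Rightarrow> ('a \<Rightarrow> 'a) \<Rightarrow>
   ('k, 'a) tens2 \<Rightarrow> ('k, 'a) tens2" where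
  "tensor_map s f g t = restrict2 s (\<lambda>\<xi> \<eta>. t (\<xi> \<circ> f) (\<eta> \<circ> g))"

definition flip2 :: "('k, 'a) tens2 \<Rightarrow> ('k, 'a) tens2" where
  "flip2 t = (\<lambda>\<xi> \<eta>. t \<eta> \<xi>)"

definition flip12 :: "('k, 'a) tens3 \<Rightarrow> ('k, 'a) tens3" where
  "flip12 u = (\<lambda>\<xi> \<eta> \<zeta>. u \<eta> \<xi> \<zeta>)"

definition comult_id ::
  "('k::field \<Rightarrow> 'a::ab_group_add \<Rightarrow> 'a) \<Rightarrow> ('a \<Rightarrow> ('k, 'a) tens2) \<Rightarrow>
   ('k, 'a) tens2 \<Rightarrow> ('k, 'a) tens3" where
  "comult_id s \<Delta> t = restrict3 s (\<lambda>\<xi> \<eta> \<zeta>. t (\<lambda>a. \<Delta> a \<xi> \<eta>) \<zeta>)"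

definition id_comult ::
  "('k::field \<Rightarrow> 'a::ab_group_add \<Rightarrow> 'a) \<Rightarrow> ('a \<Rightarrow> ('k, 'a) tens2) \<Rightarrow>
   ('k, 'a) tens2 \<Rightarrow> ('k, 'a) tens3" where
  "id_comult s \<Delta> t = restrict3 s (\<lambda>\<xi> \<eta> \<zeta>. t \<xi> (\<lambda>a. \<Delta> a \<eta> \<zeta>))"

definition sharp ::
  "('k::field \<Rightarrow> 'a::ab_group_add \<Rightarrow> 'a) \<Rightarrow> ('k, 'a) tens2 \<Rightarrow> ('a \<Rightarrow> 'k) \<Rightarrow> 'a" where
  "sharp s r \<xi> = (THE a. \<forall>\<eta>\<in>dual_space s. \<eta> a = r \<xi> \<eta>)"

definition dual_linear_iso ::
  "('k::field \<Rightarrow> 'a::ab_group_add \<Rightarrow> 'a) \<Rightarrow> (('a \<Rightarrow> 'k) \<Rightarrow> 'a) \<Rightarrow> bool" where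
  "dual_linear_iso s f \<longleftrightarrow>
     (\<forall>\<xi>\<in>dual_space s. \<forall>\<eta>\<in>dual_space s. f (\<xi> + \<eta>) = f \<xi> + f \<eta>) \<and>
     (\<forall>c. \<forall>\<xi>\<in>dual_space s. f (\<lambda>a. c * \<xi> a) = s c (f \<xi>)) \<and>
     bij_betw f (dual_space s) UNIV"


section \<open>Anti-Leibniz algebras and bialgebras\<close>

locale anti_leibniz_algebra = vector_space scale
  for scale :: "'k::field_char_0 \<Rightarrow> 'a::ab_group_add \<Rightarrow> 'a" +
  fixes mult :: "'a \<Rightarrow> 'a \<Rightarrow> 'a" (infixl "\<cdot>" 70)
  assumes finite_dim: "\<exists>Basis. finite_dimensional_vector_space scale Basis"
    and linear_mult_right: "Vector_Spaces.linear scale scale (\<lambda>b. a \<cdot> b)"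
    and linear_mult_left: "Vector_Spaces.linear scale scale (\<lambda>b. b \<cdot> a)"
    and anti_leibniz: "a1 \<cdot> (a2 \<cdot> a3) + (a1 \<cdot> a2) \<cdot> a3 + a2 \<cdot> (a1 \<cdot> a3) = 0"

definition lmul :: "('a \<Rightarrow> 'a \<Rightarrow> 'a) \<Rightarrow> 'a \<Rightarrow> 'a \<Rightarrow> 'a" where
  "lmul m a = (\<lambda>b. m a b)"

definition rmul :: "('a \<Rightarrow> 'a \<Rightarrow> 'a) \<Rightarrow> 'a \<Rightarrow> 'a \<Rightarrow> 'a" where
  "rmul m a = (\<lambda>b. m b a)"

text \<open>Quantifying over all representations \<open>r = \<Sum>\<^sub>i x\<^sub>i \<otimes> y\<^sub>i\<close> is harmless: by
  \<open>aybe_sum_cong\<close> the left-hand side does not depend on the chosen one.\<close>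

definition aybe_sum ::
  "('k::field \<Rightarrow> 'a::ab_group_add \<Rightarrow> 'a) \<Rightarrow> ('a \<Rightarrow> 'a \<Rightarrow> 'a) \<Rightarrow> ('a \<times> 'a) list \<Rightarrow> ('k, 'a) tens3" where
  "aybe_sum s m xs =
     (\<Sum>(xi, yi)\<leftarrow>xs. \<Sum>(xj, yj)\<leftarrow>xs.
        tensor3 s (m xi xj) yi yj + tensor3 s xi (m yi xj) yj
        - tensor3 s xj (m xi yj) yi - tensor3 s xj xi (m yi yj))"

definition anti_leibniz_YBE ::
  "('k::field \<Rightarrow> 'a::ab_group_add \<Rightarrow> 'a) \<Rightarrow> ('a \<Rightarrow> 'a \<Rightarrow> 'a) \<Rightarrow> ('k, 'a) tens2 \<Rightarrow> bool" where
  "anti_leibniz_YBE s m r \<longleftrightarrow>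
     r \<in> tensor_square s \<and>
     (\<forall>xs. r = (\<Sum>(x, y)\<leftarrow>xs. tensor2 s x y) \<longrightarrow> aybe_sum s m xs = 0)"

definition coboundary ::
  "('k::field \<Rightarrow> 'a::ab_group_add \<Rightarrow> 'a) \<Rightarrow> ('a \<Rightarrow> 'a \<Rightarrow> 'a) \<Rightarrow> ('k, 'a) tens2 \<Rightarrow>
   'a \<Rightarrow> ('k, 'a) tens2" where
  "coboundary s m r a =
     tensor_map s (rmul m a - lmul m a) id r + tensor_map s id (rmul m a) r"

definition invariant_tensor ::
  "('k::field \<Rightarrow> 'a::ab_group_add \<Rightarrow> 'a) \<Rightarrow> ('a \<Rightarrow> 'a \<Rightarrow> 'a) \<Rightarrow> ('k, 'a) tens2 \<Rightarrow> bool" where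
  "invariant_tensor s m t \<longleftrightarrow>
     (\<forall>a. tensor_map s (rmul m a - lmul m a) id t + tensor_map s id (rmul m a) t = 0)"

definition anti_leibniz_bialgebra ::
  "('k::field_char_0 \<Rightarrow> 'a::ab_group_add \<Rightarrow> 'a) \<Rightarrow> ('a \<Rightarrow> 'a \<Rightarrow> 'a) \<Rightarrow>
   ('a \<Rightarrow> ('k, 'a) tens2) \<Rightarrow> bool" where
  "anti_leibniz_bialgebra s m \<Delta> \<longleftrightarrow>
     anti_leibniz_algebra s m \<and>
     range \<Delta> \<subseteq> tensor_square s \<and> Vector_Spaces.linear s tens2_scale \<Delta> \<and>
     (\<forall>a. comult_id s \<Delta> (\<Delta> a) + id_comult s \<Delta> (\<Delta> a) + flip12 (id_comult s \<Delta> (\<Delta> a)) = 0) \<and>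
     (\<forall>a1 a2.
        \<Delta> (m a1 a2)
        + (let D = \<Delta> a1 - flip2 (\<Delta> a1) in
             tensor_map s id (rmul m a2) D - tensor_map s (rmul m a2) id D
             + tensor_map s (lmul m a2) id D)
        + (tensor_map s id (lmul m a1) (\<Delta> a2) + tensor_map s (lmul m a1) id (\<Delta> a2)) = 0) \<and>
     (\<forall>a1 a2.
        tensor_map s (rmul m a1) id (\<Delta> a2) - flip2 (tensor_map s (rmul m a2) id (\<Delta> a1)) = 0)"

definition quasi_triangular ::
  "('k::field_char_0 \<Rightarrow> 'a::ab_group_add \<Rightarrow> 'a) \<Rightarrow> ('a \<Rightarrow> 'a \<Rightarrow> 'a) \<Rightarrow> ('k, 'a) tens2 \<Rightarrow> bool" where
  "quasi_triangular s m r \<longleftrightarrow>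
     anti_leibniz_YBE s m r \<and> invariant_tensor s m (r - flip2 r) \<and>
     anti_leibniz_bialgebra s m (coboundary s m r)"

definition sharp_diff ::
  "('k::field \<Rightarrow> 'a::ab_group_add \<Rightarrow> 'a) \<Rightarrow> ('k, 'a) tens2 \<Rightarrow> ('a \<Rightarrow> 'k) \<Rightarrow> 'a" where
  "sharp_diff s r \<xi> = sharp s r \<xi> - sharp s (flip2 r) \<xi>"

definition factorizable ::
  "('k::field_char_0 \<Rightarrow> 'a::ab_group_add \<Rightarrow> 'a) \<Rightarrow> ('a \<Rightarrow> 'a \<Rightarrow> 'a) \<Rightarrow> ('k, 'a) tens2 \<Rightarrow> bool" where
  "factorizable s m r \<longleftrightarrow> quasi_triangular s m r \<and> dual_linear_iso s (sharp_diff s r)"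


section \<open>Skew-quadratic Rota--Baxter anti-Leibniz algebras\<close>

definition bilinear_form ::
  "('k::field \<Rightarrow> 'a::ab_group_add \<Rightarrow> 'a) \<Rightarrow> ('a \<Rightarrow> 'a \<Rightarrow> 'k) \<Rightarrow> bool" where
  "bilinear_form s B \<longleftrightarrow>
     (\<forall>a. Vector_Spaces.linear s (*) (\<lambda>b. B a b)) \<and> (\<forall>a. Vector_Spaces.linear s (*) (\<lambda>b. B b a))"

definition nondegenerate :: "('a::zero \<Rightarrow> 'a \<Rightarrow> 'k::zero) \<Rightarrow> bool" where
  "nondegenerate B \<longleftrightarrow>
     (\<forall>a. (\<forall>b. B a b = 0) \<longrightarrow> a = 0) \<and> (\<forall>a. (\<forall>b. B b a = 0) \<longrightarrow> a = 0)"

definition skew_symmetric :: "('a \<Rightarrow> 'a \<Rightarrow> 'k::uminus) \<Rightarrow> bool" where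
  "skew_symmetric B \<longleftrightarrow> (\<forall>a1 a2. B a1 a2 = - B a2 a1)"

definition invariant_form :: "('a::minus \<Rightarrow> 'a \<Rightarrow> 'a) \<Rightarrow> ('a \<Rightarrow> 'a \<Rightarrow> 'k) \<Rightarrow> bool" where
  "invariant_form m B \<longleftrightarrow> (\<forall>a1 a2 a3. B (m a1 a2) a3 = B a1 (m a2 a3 - m a3 a2))"

definition rota_baxter ::
  "('k::field \<Rightarrow> 'a::ab_group_add \<Rightarrow> 'a) \<Rightarrow> ('a \<Rightarrow> 'a \<Rightarrow> 'a) \<Rightarrow> 'k \<Rightarrow> ('a \<Rightarrow> 'a) \<Rightarrow> bool" where
  "rota_baxter s m lam R \<longleftrightarrow>
     Vector_Spaces.linear s s R \<and>
     (\<forall>a1 a2. m (R a1) (R a2) = R (m (R a1) a2 + m a1 (R a2) + s lam (m a1 a2)))"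

definition skew_quadratic_RB ::
  "('k::field_char_0 \<Rightarrow> 'a::ab_group_add \<Rightarrow> 'a) \<Rightarrow> ('a \<Rightarrow> 'a \<Rightarrow> 'a) \<Rightarrow>
   ('a \<Rightarrow> 'a \<Rightarrow> 'k) \<Rightarrow> ('a \<Rightarrow> 'a) \<Rightarrow> 'k \<Rightarrow> bool" where
  "skew_quadratic_RB s m B R lam \<longleftrightarrow>
     anti_leibniz_algebra s m \<and>
     bilinear_form s B \<and> nondegenerate B \<and> skew_symmetric B \<and> invariant_form m B \<and>
     rota_baxter s m lam R \<and>
     (\<forall>a1 a2. B (R a1) a2 + B a1 (R a2) + lam * B a1 a2 = 0)"

text \<open>The isomorphism \<open>A\<^sup>* \<rightarrow> A\<close> whose inverse is \<open>a \<mapsto> B a\<close>; only meaningful on the dual space and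
  for nondegenerate \<open>B\<close>, see \<open>form_iso\<close>.\<close>

definition form_iso :: "('a \<Rightarrow> 'a \<Rightarrow> 'k) \<Rightarrow> ('a \<Rightarrow> 'k) \<Rightarrow> 'a" where
  "form_iso B = inv B"


section \<open>Well-definedness\<close>

lemma dual_spaceD:
  assumes "\<xi> \<in> dual_space s"
  shows "\<xi> (a + b) = \<xi> a + \<xi> b" "\<xi> (a - b) = \<xi> a - \<xi> b" "\<xi> (s c a) = c * \<xi> a" "\<xi> 0 = 0"
    "\<xi> (sum_list as) = (\<Sum>a\<leftarrow>as. \<xi> a)" "\<xi> (sum g S) = (\<Sum>a\<in>S. \<xi> (g a))"
proof -
  interpret Vector_Spaces.linear s "(*)" \<xi>
    using assms by (simp add: dual_space_def)
  show "\<xi> (a + b) = \<xi> a + \<xi> b" "\<xi> (a - b) = \<xi> a - \<xi> b" "\<xi> (s c a) = c * \<xi> a" "\<xi> 0 = 0"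
    by (fact add diff scale zero)+
  show "\<xi> (sum_list as) = (\<Sum>a\<leftarrow>as. \<xi> a)"
    by (induction as) (simp_all add: add zero)
  show "\<xi> (sum g S) = (\<Sum>a\<in>S. \<xi> (g a))"
    by (fact sum)
qed

lemma dual_space_comp:
  "Vector_Spaces.linear s s f \<Longrightarrow> \<xi> \<in> dual_space s \<Longrightarrow> \<xi> \<circ> f \<in> dual_space s"
  by (auto simp: dual_space_def intro: Vector_Spaces.linear_compose)

lemma vector_space_field: "vector_space ((*) :: 'k::field \<Rightarrow> 'k \<Rightarrow> 'k)"
  by unfold_locales (simp_all add: algebra_simps)

lemma dual_spaceI:
  assumes "vector_space s" "\<And>a b. \<xi> (a + b) = \<xi> a + \<xi> b" "\<And>c a. \<xi> (s c a) = c * \<xi> a"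
  shows "\<xi> \<in> dual_space s"
  using assms by (simp add: dual_space_def Vector_Spaces.linear_iff vector_space_field)

lemma dual_space_separates:
  assumes "vector_space s" "\<And>\<xi>. \<xi> \<in> dual_space s \<Longrightarrow> \<xi> a = \<xi> b"
  shows "a = b"
proof (rule ccontr)
  assume ne: "a \<noteq> b"
  interpret vector_space s by (fact assms(1))
  interpret vector_space_pair s "(*)"
    using vector_space_field assms(1) by (simp add: vector_space_pair_def)
  have "independent {a - b}" using ne by simp
  then obtain \<xi> where "Vector_Spaces.linear s (*) \<xi>" "\<xi> (a - b) = 1"
    using linear_independent_extend[of "{a - b}" "\<lambda>_. 1"] by auto
  then show False
    using assms(2)[of \<xi>] dual_spaceD(2)[of \<xi> s a b] by (simp add: dual_space_def)
qed

lemma tensor2_apply [simp]: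
  "\<xi> \<in> dual_space s \<Longrightarrow> \<eta> \<in> dual_space s \<Longrightarrow> tensor2 s x y \<xi> \<eta> = \<xi> x * \<eta> y"
  by (simp add: tensor2_def restrict2_def)

lemma tensor3_apply [simp]:
  "\<xi> \<in> dual_space s \<Longrightarrow> \<eta> \<in> dual_space s \<Longrightarrow> \<zeta> \<in> dual_space s \<Longrightarrow>
   tensor3 s x y z \<xi> \<eta> \<zeta> = \<xi> x * \<eta> y * \<zeta> z"
  by (simp add: tensor3_def restrict3_def)

lemma sum_list_apply2:
  fixes f :: "'i \<Rightarrow> 'a \<Rightarrow> 'b \<Rightarrow> 'k::comm_monoid_add"
  shows "(\<Sum>x\<leftarrow>xs. f x) \<xi> \<eta> = (\<Sum>x\<leftarrow>xs. f x \<xi> \<eta>)"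
  by (induction xs) simp_all

lemma sum_list_apply3:
  fixes f :: "'i \<Rightarrow> 'a \<Rightarrow> 'b \<Rightarrow> 'c \<Rightarrow> 'k::comm_monoid_add"
  shows "(\<Sum>x\<leftarrow>xs. f x) \<xi> \<eta> \<zeta> = (\<Sum>x\<leftarrow>xs. f x \<xi> \<eta> \<zeta>)"
  by (induction xs) simp_all

lemma tensor_map_tensor2:
  assumes "Vector_Spaces.linear s s f" "Vector_Spaces.linear s s g"
  shows "tensor_map s f g (tensor2 s x y) = tensor2 s (f x) (g y)"
  using assms by (auto simp: tensor_map_def tensor2_def restrict2_def fun_eq_iff dual_space_comp)

lemma flip2_tensor2: "flip2 (tensor2 s x y) = tensor2 s y x"
  by (auto simp: flip2_def tensor2_def restrict2_def fun_eq_iff)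

lemma flip12_tensor3: "flip12 (tensor3 s x y z) = tensor3 s y x z"
  by (auto simp: flip12_def tensor3_def restrict3_def fun_eq_iff)

lemma comult_apply_dual:
  assumes "Vector_Spaces.linear s tens2_scale \<Delta>"
  shows "(\<lambda>a. \<Delta> a \<xi> \<eta>) \<in> dual_space s"
proof -
  interpret Vector_Spaces.linear s tens2_scale \<Delta> by (fact assms)
  show ?thesis
    by (rule dual_spaceI) (simp_all add: vs1.vector_space_axioms add scale tens2_scale_def)
qed

lemma comult_id_tensor2:
  assumes "Vector_Spaces.linear s tens2_scale \<Delta>" "\<Delta> x = (\<Sum>(u, v)\<leftarrow>xs. tensor2 s u v)"
  shows "comult_id s \<Delta> (tensor2 s x y) = (\<Sum>(u, v)\<leftarrow>xs. tensor3 s u v y)"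
proof (intro ext)
  have D: "\<Delta> x \<xi> \<eta> = (\<Sum>(u, v)\<leftarrow>xs. tensor2 s u v \<xi> \<eta>)" for \<xi> \<eta>
    unfolding assms(2) by (simp add: sum_list_apply2 split_def)
  fix \<xi> \<eta> \<zeta> :: "'b \<Rightarrow> 'a"
  show "comult_id s \<Delta> (tensor2 s x y) \<xi> \<eta> \<zeta> = (\<Sum>(u, v)\<leftarrow>xs. tensor3 s u v y) \<xi> \<eta> \<zeta>"
    using comult_apply_dual[OF assms(1)]
    by (auto simp: comult_id_def restrict3_def D sum_list_apply3 split_def tensor2_def tensor3_def
        restrict2_def sum_list_mult_const)
qed

lemma id_comult_tensor2:
  assumes "Vector_Spaces.linear s tens2_scale \<Delta>" "\<Delta> y = (\<Sum>(u, v)\<leftarrow>xs. tensor2 s u v)"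
  shows "id_comult s \<Delta> (tensor2 s x y) = (\<Sum>(u, v)\<leftarrow>xs. tensor3 s x u v)"
proof (intro ext)
  have D: "\<Delta> y \<xi> \<eta> = (\<Sum>(u, v)\<leftarrow>xs. tensor2 s u v \<xi> \<eta>)" for \<xi> \<eta>
    unfolding assms(2) by (simp add: sum_list_apply2 split_def)
  fix \<xi> \<eta> \<zeta> :: "'b \<Rightarrow> 'a"
  show "id_comult s \<Delta> (tensor2 s x y) \<xi> \<eta> \<zeta> = (\<Sum>(u, v)\<leftarrow>xs. tensor3 s x u v) \<xi> \<eta> \<zeta>"
    using comult_apply_dual[OF assms(1)]
    by (auto simp: id_comult_def restrict3_def D sum_list_apply3 split_def tensor2_def tensor3_def
        restrict2_def sum_list_const_mult mult.assoc)
qed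

lemma sharp_eqI:
  assumes "vector_space s" "\<And>\<eta>. \<eta> \<in> dual_space s \<Longrightarrow> \<eta> a = r \<xi> \<eta>"
  shows "sharp s r \<xi> = a"
  unfolding sharp_def
proof (rule the_equality)
  show "\<forall>\<eta>\<in>dual_space s. \<eta> a = r \<xi> \<eta>" using assms(2) by blast
  show "b = a" if "\<forall>\<eta>\<in>dual_space s. \<eta> b = r \<xi> \<eta>" for b
    by (rule dual_space_separates[OF assms(1)]) (use that assms(2) in simp)
qed

lemma sharp_sum_list:
  assumes "vector_space s" "\<xi> \<in> dual_space s"
  shows "sharp s (\<Sum>(x, y)\<leftarrow>xs. tensor2 s x y) \<xi> = (\<Sum>(x, y)\<leftarrow>xs. s (\<xi> x) y)"
proof (rule sharp_eqI[OF assms(1)])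
  fix \<eta> assume \<eta>: "\<eta> \<in> dual_space s"
  show "\<eta> (\<Sum>(x, y)\<leftarrow>xs. s (\<xi> x) y) = (\<Sum>(x, y)\<leftarrow>xs. tensor2 s x y) \<xi> \<eta>"
    using \<eta> assms(2) by (simp add: dual_spaceD[OF \<eta>] sum_list_apply2 split_def o_def)
qed

lemma flip2_sum_list:
  "flip2 (\<Sum>(x, y)\<leftarrow>xs. tensor2 s x y) = (\<Sum>(x, y)\<leftarrow>map prod.swap xs. tensor2 s x y)"
  by (intro ext) (simp add: flip2_def sum_list_apply2 split_def o_def tensor2_def restrict2_def
      conj_commute mult.commute cong: if_cong)

lemma dual_mult_sum_list:
  assumes A: "anti_leibniz_algebra s m" and \<xi>: "\<xi> \<in> dual_space s"
  shows "\<xi> (m (\<Sum>p\<leftarrow>xs. s (f p) (u p)) (\<Sum>q\<leftarrow>ys. s (g q) (v q))) =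
    (\<Sum>p\<leftarrow>xs. \<Sum>q\<leftarrow>ys. f p * g q * \<xi> (m (u p) (v q)))"
proof -
  have L: "(\<lambda>a. \<xi> (m a b)) \<in> dual_space s" for b
    using dual_space_comp[OF anti_leibniz_algebra.linear_mult_left[OF A] \<xi>] by (simp add: o_def)
  have R: "(\<lambda>b. \<xi> (m a b)) \<in> dual_space s" for a
    using dual_space_comp[OF anti_leibniz_algebra.linear_mult_right[OF A] \<xi>] by (simp add: o_def)
  have "\<xi> (m (\<Sum>p\<leftarrow>xs. s (f p) (u p)) b) = (\<Sum>p\<leftarrow>xs. f p * \<xi> (m (u p) b))" for b
    using dual_spaceD(5)[OF L] dual_spaceD(3)[OF L] by (simp add: o_def)
  then have 1: "\<xi> (m (\<Sum>p\<leftarrow>xs. s (f p) (u p)) (\<Sum>q\<leftarrow>ys. s (g q) (v q))) =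
      (\<Sum>p\<leftarrow>xs. f p * \<xi> (m (u p) (\<Sum>q\<leftarrow>ys. s (g q) (v q))))" .
  have "\<xi> (m a (\<Sum>q\<leftarrow>ys. s (g q) (v q))) = (\<Sum>q\<leftarrow>ys. g q * \<xi> (m a (v q)))" for a
    using dual_spaceD(5)[OF R] dual_spaceD(3)[OF R] by (simp add: o_def)
  then have 2: "(\<Sum>p\<leftarrow>xs. f p * \<xi> (m (u p) (\<Sum>q\<leftarrow>ys. s (g q) (v q)))) =
      (\<Sum>p\<leftarrow>xs. \<Sum>q\<leftarrow>ys. f p * g q * \<xi> (m (u p) (v q)))"
    by (simp add: sum_list_const_mult mult.assoc)
  show ?thesis unfolding 1 2 ..
qed

lemma aybe_sum_apply:
  assumes A: "anti_leibniz_algebra s m" and r: "r = (\<Sum>(x, y)\<leftarrow>xs. tensor2 s x y)"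
    and d: "\<xi> \<in> dual_space s" "\<eta> \<in> dual_space s" "\<zeta> \<in> dual_space s"
  defines "P \<equiv> sharp s r" and "Q \<equiv> sharp s (flip2 r)"
  shows "aybe_sum s m xs \<xi> \<eta> \<zeta> =
    \<xi> (m (Q \<eta>) (Q \<zeta>)) + \<eta> (m (P \<xi>) (Q \<zeta>)) - \<eta> (m (Q \<zeta>) (P \<xi>)) - \<zeta> (m (P \<eta>) (P \<xi>))"
proof -
  interpret anti_leibniz_algebra s m by (fact A)
  have P: "P \<omega> = (\<Sum>p\<leftarrow>xs. s (\<omega> (fst p)) (snd p))" if "\<omega> \<in> dual_space s" for \<omega>
    unfolding P_def r using sharp_sum_list[OF vector_space_axioms that] by (simp add: split_def)
  have Q: "Q \<omega> = (\<Sum>p\<leftarrow>xs. s (\<omega> (snd p)) (fst p))" if "\<omega> \<in> dual_space s" for \<omega>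
    unfolding Q_def r flip2_sum_list
    using sharp_sum_list[OF vector_space_axioms that, of "map prod.swap xs"]
    by (simp add: split_def o_def)
  show ?thesis
    using d unfolding P[OF d(1)] P[OF d(2)] Q[OF d(2)] Q[OF d(3)]
      dual_mult_sum_list[OF A d(1)] dual_mult_sum_list[OF A d(2)] dual_mult_sum_list[OF A d(3)]
    by (simp add: aybe_sum_def sum_list_apply3 split_def sum_list_addf sum_list_subtractf mult_ac)
qed

lemma aybe_sum_cong:
  assumes A: "anti_leibniz_algebra s m"
    and eq: "(\<Sum>(x, y)\<leftarrow>xs. tensor2 s x y) = (\<Sum>(x, y)\<leftarrow>ys. tensor2 s x y)"
  shows "aybe_sum s m xs = aybe_sum s m ys"
proof (intro ext)
  fix \<xi> \<eta> \<zeta>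
  show "aybe_sum s m xs \<xi> \<eta> \<zeta> = aybe_sum s m ys \<xi> \<eta> \<zeta>"
  proof (cases "\<xi> \<in> dual_space s \<and> \<eta> \<in> dual_space s \<and> \<zeta> \<in> dual_space s")
    case True
    then show ?thesis
      using aybe_sum_apply[OF A refl, of \<xi> \<eta> \<zeta> xs] aybe_sum_apply[OF A refl, of \<xi> \<eta> \<zeta> ys] eq by simp
  next
    case False
    then have "aybe_sum s m zs \<xi> \<eta> \<zeta> = 0" for zs
      by (auto simp: aybe_sum_def sum_list_apply3 split_def tensor3_def restrict3_def)
    then show ?thesis by simp
  qed
qed

lemma dual_expansion:
  assumes "finite_dimensional_vector_space s Basis" "\<xi> \<in> dual_space s"
  shows "\<xi> a = (\<Sum>b\<in>Basis. module.representation s Basis a b * \<xi> b)"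
proof -
  interpret finite_dimensional_vector_space s Basis by (fact assms(1))
  have "\<xi> a = \<xi> (\<Sum>b\<in>Basis. s (representation Basis a b) b)"
    using sum_representation_eq[of Basis a Basis] independent_Basis finite_Basis span_Basis by simp
  then show ?thesis
    by (simp add: dual_spaceD[OF assms(2)])
qed

lemma dual_space_coord:
  assumes "finite_dimensional_vector_space s Basis"
  shows "(\<lambda>a. module.representation s Basis a b) \<in> dual_space s"
proof -
  interpret finite_dimensional_vector_space s Basis by (fact assms)
  show ?thesis
    using linear_representation[OF independent_Basis span_Basis] by (simp add: dual_space_def)
qed

lemma tensor_square_universal:
  assumes fd: "finite_dimensional_vector_space s Basis" and V: "vector_space sv"
    and \<beta>: "\<And>x. Vector_Spaces.linear s sv (\<lambda>y. \<beta> x y)" "\<And>y. Vector_Spaces.linear s sv (\<lambda>x. \<beta> x y)"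
  shows "\<exists>L. Vector_Spaces.linear tens2_scale sv L \<and> (\<forall>x y. L (tensor2 s x y) = \<beta> x y) \<and>
    (\<forall>L'. Vector_Spaces.linear tens2_scale sv L' \<and> (\<forall>x y. L' (tensor2 s x y) = \<beta> x y) \<longrightarrow>
       (\<forall>t\<in>tensor_square s. L' t = L t))"
proof -
  interpret finite_dimensional_vector_space s Basis by (fact fd)
  interpret V: vector_space sv by (fact V)
  have VT: "vector_space (tens2_scale :: 'a \<Rightarrow> ('a, 'b) tens2 \<Rightarrow> _)"
    by unfold_locales (simp_all add: tens2_scale_def fun_eq_iff algebra_simps)
  define e where "e b a = representation Basis a b" for a b
  define L where "L t = (\<Sum>i\<in>Basis. \<Sum>j\<in>Basis. sv (t (e i) (e j)) (\<beta> i j))" for t :: "('a, 'b) tens2"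
  have lin: "Vector_Spaces.linear tens2_scale sv L"
    using VT V by (simp add: Vector_Spaces.linear_iff L_def tens2_scale_def V.scale_left_distrib
        sum.distrib V.scale_sum_right)
  have e: "e b \<in> dual_space s" for b
    using dual_space_coord[OF fd] by (simp add: e_def[abs_def])
  have exp: "a = (\<Sum>b\<in>Basis. s (e b a) b)" for a
    using sum_representation_eq[of Basis a Basis] independent_Basis finite_Basis span_Basis
    by (simp add: e_def)
  have val: "L (tensor2 s x y) = \<beta> x y" for x y
  proof -
    interpret r: Vector_Spaces.linear s sv "\<lambda>w. \<beta> u w" for u by (fact \<beta>(1))
    interpret l: Vector_Spaces.linear s sv "\<lambda>u. \<beta> u w" for w by (fact \<beta>(2))
    have "\<beta> x y = \<beta> (\<Sum>b\<in>Basis. s (e b x) b) (\<Sum>b\<in>Basis. s (e b y) b)"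
      using exp by metis
    also have "\<dots> = (\<Sum>i\<in>Basis. \<Sum>j\<in>Basis. sv (e i x) (sv (e j y) (\<beta> i j)))"
      unfolding l.sum l.scale unfolding r.sum r.scale V.scale_sum_right ..
    finally show ?thesis
      by (simp add: L_def e)
  qed
  have uniq: "L' t = L t"
    if L': "Vector_Spaces.linear tens2_scale sv L'" "\<forall>x y. L' (tensor2 s x y) = L (tensor2 s x y)"
      and t: "t \<in> tensor_square s" for L' t
  proof -
    obtain xs where "t = (\<Sum>(x, y)\<leftarrow>xs. tensor2 s x y)"
      using t by (auto simp: tensor_square_def)
    then show ?thesis
    proof (induction xs arbitrary: t)
      case Nil
      have "L' 0 = 0" "L 0 = 0"
        using L'(1) lin module_hom.zero unfolding Vector_Spaces.linear_def by blast+
      with Nil show ?case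
        by (simp only: list.map sum_list.Nil)
    next
      case (Cons p xs)
      let ?u = "\<Sum>(x, y)\<leftarrow>xs. tensor2 s x y"
      have "L' (u + v) = L' u + L' v" "L (u + v) = L u + L v" for u v
        using L'(1) lin module_hom.add[of tens2_scale sv L'] module_hom.add[of tens2_scale sv L]
        by (simp_all only: Vector_Spaces.linear_def)
      moreover have "t = tensor2 s (fst p) (snd p) + ?u"
        unfolding Cons.prems by (simp only: list.map sum_list.Cons split_def)
      ultimately show ?case
        using L'(2) Cons.IH[OF refl] by metis
    qed
  qed
  show ?thesis
  proof (intro exI[of _ L] conjI allI impI ballI)
    fix L' t
    assume L': "Vector_Spaces.linear tens2_scale sv L' \<and> (\<forall>x y. L' (tensor2 s x y) = \<beta> x y)"
      and t: "t \<in> tensor_square s"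
    show "L' t = L t"
      by (rule uniq[OF _ _ t]) (use L' val in metis)+
  qed (fact lin val)+
qed

lemma form_iso:
  assumes fd: "finite_dimensional_vector_space s Basis"
    and B: "bilinear_form s B" "nondegenerate B"
  shows "dual_linear_iso s (form_iso B)" "inv_into (dual_space s) (form_iso B) a = B a"
proof -
  interpret finite_dimensional_vector_space s Basis by (fact fd)
  have Br: "B a \<in> dual_space s" and Bl: "(\<lambda>b. B b a) \<in> dual_space s" for a
    using B(1) by (auto simp: bilinear_form_def dual_space_def)
  have inj: "inj B"
  proof (rule injI)
    fix a b assume "B a = B b"
    then have "B (a - b) c = 0" for c
      using dual_spaceD(2)[OF Bl] by simp
    then have "a - b = 0" using B(2) unfolding nondegenerate_def by blast
    then show "a = b" by simp
  qed
  have dual_ext: "\<xi> = \<eta>"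
    if "\<xi> \<in> dual_space s" "\<eta> \<in> dual_space s" "\<And>b. b \<in> Basis \<Longrightarrow> \<xi> b = \<eta> b" for \<xi> \<eta>
  proof
    fix a
    have "(\<Sum>b\<in>Basis. representation Basis a b * \<xi> b) = (\<Sum>b\<in>Basis. representation Basis a b * \<eta> b)"
      using that(3) by (intro sum.cong) simp_all
    then show "\<xi> a = \<eta> a"
      unfolding dual_expansion[OF fd that(1), of a] dual_expansion[OF fd that(2), of a] .
  qed
  define F where "F a = (\<Sum>b\<in>Basis. s (B a b) b)" for a
  have coeffs: "f b = g b"
    if "(\<Sum>b\<in>Basis. s (f b) b) = (\<Sum>b\<in>Basis. s (g b) b)" "b \<in> Basis" for f g b
  proof -
    have "(\<Sum>b\<in>Basis. s (f b - g b) b) = 0"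
      using that(1) by (simp add: scale_left_diff_distrib sum_subtractf)
    then show "f b = g b"
      using independentD[OF independent_Basis finite_Basis subset_refl, of "\<lambda>b. f b - g b" b] that(2)
      by simp
  qed
  have "Vector_Spaces.linear s s F"
    by (simp add: Vector_Spaces.linear_iff vector_space_axioms F_def dual_spaceD[OF Bl]
        scale_left_distrib sum.distrib scale_sum_right)
  moreover have "inj F"
  proof (rule injI)
    fix a b assume "F a = F b"
    then have "B a = B b"
      unfolding F_def by (intro dual_ext Br) (rule coeffs)
    then show "a = b" using inj by (simp add: inj_eq)
  qed
  ultimately have "surj F"
    by (rule linear_inj_imp_surj)
  have surj: "\<exists>a. B a = \<xi>" if \<xi>: "\<xi> \<in> dual_space s" for \<xi>
  proof -
    obtain a where "F a = (\<Sum>b\<in>Basis. s (\<xi> b) b)"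
      using \<open>surj F\<close> by (metis surjD)
    then have "B a = \<xi>"
      unfolding F_def by (intro dual_ext Br \<xi>) (rule coeffs)
    then show ?thesis ..
  qed
  have inv: "form_iso B (B a) = a" for a
    using inj by (simp add: form_iso_def)
  have inv': "B (form_iso B \<xi>) = \<xi>" if "\<xi> \<in> dual_space s" for \<xi>
    using surj[OF that] inv by auto
  have bij: "bij_betw (form_iso B) (dual_space s) UNIV"
    by (rule bij_betw_byWitness[where f' = B]) (use inv inv' Br in auto)
  have "B (a + b) = B a + B b" and "B (s c a) = (\<lambda>x. c * B a x)" for a b c
    using dual_spaceD(1,3)[OF Bl] by (auto simp: fun_eq_iff)
  note lin = this
  have "form_iso B (\<xi> + \<eta>) = form_iso B \<xi> + form_iso B \<eta>"
    if "\<xi> \<in> dual_space s" "\<eta> \<in> dual_space s" for \<xi> \<eta>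
    using inv[of "form_iso B \<xi> + form_iso B \<eta>"]
    unfolding lin(1) inv'[OF that(1)] inv'[OF that(2)] .
  moreover have "form_iso B (\<lambda>a. c * \<xi> a) = s c (form_iso B \<xi>)" if "\<xi> \<in> dual_space s" for c \<xi>
    using inv[of "s c (form_iso B \<xi>)"] unfolding lin(2) inv'[OF that] .
  ultimately show "dual_linear_iso s (form_iso B)"
    using bij unfolding dual_linear_iso_def by blast
  show "inv_into (dual_space s) (form_iso B) a = B a"
    using inv_into_f_f[OF bij_betw_imp_inj_on[OF bij] Br[of a]] unfolding inv .
qed

end

theory Submission
  imports Defs
begin

text \<open>
  Let \<open>\<I> = r\<^sup>\<sharp> - \<tau>(r)\<^sup>\<sharp>\<close> be bijective. Transporting everything along \<open>\<I>\<close>, with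
  \<open>B(x, y) = \<langle>\<I>\<^sup>-\<^sup>1 x, y\<rangle>\<close> and \<open>T = \<tau>(r)\<^sup>\<sharp> \<I>\<^sup>-\<^sup>1\<close>, the tensor \<open>r\<close> becomes the form
  \<open>(x, y) \<mapsto> B(y, T x + x)\<close>. Invariance of \<open>r - \<tau>(r)\<close> is invariance of \<open>B\<close>, and moving all operators to
  one side of \<open>B\<close> turns the Yang--Baxter equation into the Rota--Baxter identity of weight \<open>1\<close> for \<open>T\<close>.
  The product dual to \<open>\<Delta>\<^sub>r\<close> is \<open>x \<circ> y = x T(y) + T(x) y + x y\<close>, again anti-Leibniz because \<open>T\<close> is
  Rota--Baxter; the two compatibility conditions need only invariance, the adjunction
  \<open>B(T x, y) + B(x, T y) + B(x, y) = 0\<close>, and the identity \<open>(a b - b a) c = 0\<close>.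
\<close>

section \<open>Elements of the tensor square\<close>

lemma sum_list_tensor2_mem: "(\<Sum>(x, y)\<leftarrow>xs. tensor2 s x y) \<in> tensor_square s"
  unfolding tensor_square_def by blast

lemma sum_apply2:
  fixes f :: "'i \<Rightarrow> 'a \<Rightarrow> 'b \<Rightarrow> 'k::comm_monoid_add"
  shows "(\<Sum>i\<in>S. f i) \<xi> \<eta> = (\<Sum>i\<in>S. f i \<xi> \<eta>)"
  by (induction S rule: infinite_finite_induct) simp_all

lemma sum_tensor2_mem:
  assumes "finite S"
  shows "(\<Sum>b\<in>S. tensor2 s (f b) (g b)) \<in> tensor_square s"
proof -
  obtain bs where "distinct bs" "set bs = S"
    using finite_distinct_list[OF assms] by blast
  then have "(\<Sum>b\<in>S. tensor2 s (f b) (g b)) = (\<Sum>(x, y)\<leftarrow>map (\<lambda>b. (f b, g b)) bs. tensor2 s x y)"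
    by (simp add: sum_list_distinct_conv_sum_set o_def)
  then show ?thesis
    using sum_list_tensor2_mem by metis
qed

lemma tensor_square_add:
  assumes "t \<in> tensor_square s" "u \<in> tensor_square s"
  shows "t + u \<in> tensor_square s"
proof -
  obtain xs ys where "t = (\<Sum>(x, y)\<leftarrow>xs. tensor2 s x y)" "u = (\<Sum>(x, y)\<leftarrow>ys. tensor2 s x y)"
    using assms unfolding tensor_square_def by blast
  then have "t + u = (\<Sum>(x, y)\<leftarrow>xs @ ys. tensor2 s x y)" by simp
  then show ?thesis using sum_list_tensor2_mem by metis
qed

text \<open>Sums of elementary tensors inherit the default value 0 of \<open>restrict2\<close>.
  Uniqueness of a tensor with prescribed pairings rests on this.\<close>

lemma tensor_square_outside_dual:
  assumes "t \<in> tensor_square s" "\<xi> \<notin> dual_space s \<or> \<eta> \<notin> dual_space s"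
  shows "t \<xi> \<eta> = 0"
  using assms by (auto simp: tensor_square_def sum_list_apply2 split_def tensor2_def restrict2_def)

lemma tensor_map_mem:
  assumes t: "t \<in> tensor_square s"
    and f: "Vector_Spaces.linear s s f" and g: "Vector_Spaces.linear s s g"
  shows "tensor_map s f g t \<in> tensor_square s"
proof -
  obtain xs where xs: "t = (\<Sum>(x, y)\<leftarrow>xs. tensor2 s x y)"
    using t unfolding tensor_square_def by blast
  have "tensor_map s f g t = (\<Sum>(x, y)\<leftarrow>map (map_prod f g) xs. tensor2 s x y)"
    using dual_space_comp[OF f] dual_space_comp[OF g]
    by (intro ext) (auto simp: xs tensor_map_def restrict2_def sum_list_apply2 split_def o_def
        tensor2_def)
  then show ?thesis using sum_list_tensor2_mem by metis
qed

lemma tensor_square_flip2: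
  assumes "t \<in> tensor_square s"
  shows "flip2 t \<in> tensor_square s"
proof -
  obtain xs where "t = (\<Sum>(x, y)\<leftarrow>xs. tensor2 s x y)"
    using assms unfolding tensor_square_def by blast
  then show ?thesis using flip2_sum_list sum_list_tensor2_mem by metis
qed

section \<open>The map \<open>sharp\<close> on elements of the tensor square\<close>

text \<open>A representation of \<open>t\<close> gives an explicit witness for the definite
  description in \<open>sharp\<close>.\<close>

lemma sharp_apply:
  assumes V: "vector_space s" and t: "t \<in> tensor_square s"
    and d: "\<xi> \<in> dual_space s" "\<eta> \<in> dual_space s"
  shows "\<eta> (sharp s t \<xi>) = t \<xi> \<eta>"
proof -
  obtain xs where xs: "t = (\<Sum>(x, y)\<leftarrow>xs. tensor2 s x y)"
    using t unfolding tensor_square_def by blast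
  show ?thesis
    unfolding xs sharp_sum_list[OF V d(1)] using d
    by (simp add: dual_spaceD[OF d(2)] sum_list_apply2 split_def o_def)
qed

lemma dual_space_add_scale:
  assumes "vector_space s" "\<xi> \<in> dual_space s" "\<eta> \<in> dual_space s"
  shows "\<xi> + \<eta> \<in> dual_space s" "(\<lambda>a. c * \<xi> a) \<in> dual_space s"
  using assms by (auto intro!: dual_spaceI simp: dual_spaceD algebra_simps)

lemma sharp_linear:
  assumes V: "vector_space s" and t: "t \<in> tensor_square s"
    and d: "\<xi> \<in> dual_space s" "\<eta> \<in> dual_space s"
  shows "sharp s t (\<xi> + \<eta>) = sharp s t \<xi> + sharp s t \<eta>"
    and "sharp s t (\<lambda>a. c * \<xi> a) = s c (sharp s t \<xi>)"
proof -
  interpret vector_space s by (fact V)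
  obtain xs where xs: "t = (\<Sum>(x, y)\<leftarrow>xs. tensor2 s x y)"
    using t unfolding tensor_square_def by blast
  note sh = sharp_sum_list[OF V, of _ xs, folded xs]
  show "sharp s t (\<xi> + \<eta>) = sharp s t \<xi> + sharp s t \<eta>"
    using d dual_space_add_scale(1)[OF V d]
    by (simp add: sh split_def scale_left_distrib sum_list_addf)
  have "(\<Sum>(x, y)\<leftarrow>xs. s (c * \<xi> x) y) = s c (\<Sum>(x, y)\<leftarrow>xs. s (\<xi> x) y)"
    by (induction xs) (auto simp: scale_right_distrib)
  then show "sharp s t (\<lambda>a. c * \<xi> a) = s c (sharp s t \<xi>)"
    using d dual_space_add_scale(2)[OF V d] by (simp add: sh)
qed

section \<open>Skew-quadratic anti-Leibniz algebras\<close>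

context anti_leibniz_algebra
begin

lemma mult_simps [simp]:
  "(a + b) \<cdot> c = a \<cdot> c + b \<cdot> c" "(a - b) \<cdot> c = a \<cdot> c - b \<cdot> c" "(- a) \<cdot> c = - (a \<cdot> c)"
  "scale k a \<cdot> c = scale k (a \<cdot> c)"
  "c \<cdot> (a + b) = c \<cdot> a + c \<cdot> b" "c \<cdot> (a - b) = c \<cdot> a - c \<cdot> b" "c \<cdot> (- a) = - (c \<cdot> a)"
  "c \<cdot> scale k a = scale k (c \<cdot> a)"
proof -
  interpret l: Vector_Spaces.linear scale scale "\<lambda>b. b \<cdot> c" by (fact linear_mult_left)
  interpret r: Vector_Spaces.linear scale scale "\<lambda>b. c \<cdot> b" by (fact linear_mult_right)
  show "(a + b) \<cdot> c = a \<cdot> c + b \<cdot> c" "(a - b) \<cdot> c = a \<cdot> c - b \<cdot> c" "(- a) \<cdot> c = - (a \<cdot> c)"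
    "scale k a \<cdot> c = scale k (a \<cdot> c)"
    by (fact l.add l.diff l.neg l.scale)+
  show "c \<cdot> (a + b) = c \<cdot> a + c \<cdot> b" "c \<cdot> (a - b) = c \<cdot> a - c \<cdot> b" "c \<cdot> (- a) = - (c \<cdot> a)"
    "c \<cdot> scale k a = scale k (c \<cdot> a)"
    by (fact r.add r.diff r.neg r.scale)+
qed

text \<open>\<open>a (b c) + b (a c)\<close> is symmetric in \<open>a\<close> and \<open>b\<close>, hence so is \<open>(a b) c\<close>.\<close>

lemma mult_swap: "(a \<cdot> b) \<cdot> c = (b \<cdot> a) \<cdot> c"
  using anti_leibniz[of a b c] anti_leibniz[of b a c]
  by (metis add.commute add.left_commute add_left_cancel)

lemma mult_right_assoc: "a \<cdot> (b \<cdot> c) = - ((a \<cdot> b) \<cdot> c) - b \<cdot> (a \<cdot> c)"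
  using anti_leibniz[of a b c] by (simp add: eq_neg_iff_add_eq_0 algebra_simps)

lemma linear_rmul: "Vector_Spaces.linear scale scale (rmul (\<cdot>) a)"
  using linear_mult_left by (simp add: rmul_def)

lemma linear_rmul_minus_lmul: "Vector_Spaces.linear scale scale (rmul (\<cdot>) a - lmul (\<cdot>) a)"
  by (simp add: Vector_Spaces.linear_iff vector_space_axioms rmul_def lmul_def scale_right_diff_distrib)

end

locale skew_quadratic_anti_leibniz_algebra = anti_leibniz_algebra scale mult
  for scale :: "'k::field_char_0 \<Rightarrow> 'a::ab_group_add \<Rightarrow> 'a" and mult (infixl "\<cdot>" 70) +
  fixes B :: "'a \<Rightarrow> 'a \<Rightarrow> 'k"
  assumes bilinear: "bilinear_form scale B" and nondegenerate: "nondegenerate B"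
    and skew: "skew_symmetric B" and invariant: "invariant_form (\<cdot>) B"
begin

lemma form_dual: "B a \<in> dual_space scale" "(\<lambda>b. B b a) \<in> dual_space scale"
  using bilinear by (simp_all add: bilinear_form_def dual_space_def)

lemma form_simps [simp]:
  "B (a + b) c = B a c + B b c" "B (a - b) c = B a c - B b c" "B (- a) c = - B a c"
  "B (scale k a) c = k * B a c" "B 0 c = 0"
  "B c (a + b) = B c a + B c b" "B c (a - b) = B c a - B c b" "B c (- a) = - B c a"
  "B c (scale k a) = k * B c a" "B c 0 = 0"
  using dual_spaceD[OF form_dual(1)] dual_spaceD[OF form_dual(2)]
    dual_spaceD(2)[OF form_dual(1), of c 0 a] dual_spaceD(2)[OF form_dual(2), of 0 a c]
  by simp_all

lemma form_skew: "B a b = - B b a"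
  using skew unfolding skew_symmetric_def by blast

lemma form_invariant: "B (a \<cdot> b) c = B a (b \<cdot> c) - B a (c \<cdot> b)"
  using invariant unfolding invariant_form_def by simp

text \<open>Left multiplications are self-adjoint: by invariance, on one side after skewness, both
  sides equal \<open>B c (a \<cdot> b) - B c (b \<cdot> a)\<close>.\<close>

lemma form_lmul: "B a (c \<cdot> b) = B (c \<cdot> a) b"
  using form_invariant[of c b a] form_skew[of a "c \<cdot> b"] by (simp add: form_invariant)

text \<open>The adjoint of right multiplication by \<open>c\<close> is left minus right
  multiplication by \<open>c\<close>: solve invariance for this term and apply
  \<open>form_lmul\<close>.\<close>

lemma form_rmul: "B a (b \<cdot> c) = B (c \<cdot> a - a \<cdot> c) b"
  using form_invariant[of a c b] by (simp add: form_lmul)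

text \<open>The commutator on the right of the invariance identity changes sign when
  \<open>b\<close> and \<open>c\<close> are exchanged.\<close>

lemma form_swap_right: "B (a \<cdot> b) c = - B (a \<cdot> c) b"
  by (simp add: form_invariant)

lemma form_ext: "a = b" if "\<And>c. B a c = B b c"
proof -
  have "B (a - b) c = 0" for c by (simp add: that)
  then show ?thesis using nondegenerate unfolding nondegenerate_def by (metis eq_iff_diff_eq_0)
qed

text \<open>Under the identification of \<open>x\<close> with \<open>B x\<close>, the transposes
  that occur in \<open>tensor_map\<close> become operations on \<open>x\<close>.\<close>

lemma form_comp_rmul: "B x \<circ> rmul (\<cdot>) a = B (a \<cdot> x - x \<cdot> a)"
  and form_comp_lmul: "B x \<circ> lmul (\<cdot>) a = B (a \<cdot> x)"
  and form_comp_rmul_minus_lmul: "B x \<circ> (rmul (\<cdot>) a - lmul (\<cdot>) a) = B (- (x \<cdot> a))"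
  by (simp_all only: fun_eq_iff rmul_def lmul_def o_apply minus_apply form_simps
      form_rmul[of x _ a] form_lmul[of x a]) simp_all

text \<open>In finite dimension \<open>form_iso B\<close> is a bijection from the dual with inverse
  \<open>B\<close>. Tensor identities can therefore be tested on functionals
  \<open>B x\<close>.\<close>

lemma dual_space_eq_range: "dual_space scale = range B"
proof -
  obtain Basis where fd: "finite_dimensional_vector_space scale Basis"
    using finite_dim by blast
  have "bij_betw (form_iso B) (dual_space scale) UNIV"
    using form_iso(1)[OF fd bilinear nondegenerate] by (simp add: dual_linear_iso_def)
  then have "dual_space scale = inv_into (dual_space scale) (form_iso B) ` UNIV"
    using bij_betw_inv_into bij_betw_imp_surj_on by metis
  then show ?thesis
    using form_iso(2)[OF fd bilinear nondegenerate] by auto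
qed

lemma dual_space_cases:
  assumes "\<xi> \<in> dual_space scale"
  obtains x where "\<xi> = B x"
  using assms dual_space_eq_range by auto

end

section \<open>Tensors given by an operator\<close>

text \<open>Only weight one is treated; other nonzero weights are rescaled to it. The Rota--Baxter
  identity is left out because it is to be proved equivalent to the Yang--Baxter equation.\<close>

locale skew_adjoint_operator = skew_quadratic_anti_leibniz_algebra scale mult B
  for scale :: "'k::field_char_0 \<Rightarrow> 'a::ab_group_add \<Rightarrow> 'a" and mult (infixl "\<cdot>" 70) and B +
  fixes T :: "'a \<Rightarrow> 'a"
  assumes linear_T: "Vector_Spaces.linear scale scale T"
    and adjoint: "B (T x) y + B x (T y) + B x y = 0"
begin

lemma T_simps [simp]:
  "T (a + b) = T a + T b" "T (a - b) = T a - T b" "T (- a) = - T a" "T (scale k a) = scale k (T a)"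
proof -
  interpret l: Vector_Spaces.linear scale scale T by (fact linear_T)
  show "T (a + b) = T a + T b" "T (a - b) = T a - T b" "T (- a) = - T a" "T (scale k a) = scale k (T a)"
    by (fact l.add l.diff l.neg l.scale)+
qed

lemma form_T: "B (T x) y = - B x (T y) - B x y"
  using adjoint[of x y] by algebra

text \<open>Both sides are the value of \<open>r\<close> at \<open>B x\<close> and
  \<open>B y\<close>. The left one shows that \<open>sharp\<close> of \<open>r\<close> is
  \<open>T + id\<close>, the right one that \<open>sharp\<close> of the flipped tensor is
  \<open>T\<close>.\<close>

lemma form_T_comm: "B y (T x) + B y x = B x (T y)"
  using form_T[of y x] form_skew[of x "T y"] by simp

lemma form_T_swap: "B y (T x) = B x (T y) - B y x"
  using form_T_comm[of y x] by (simp add: eq_diff_eq)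

lemma ex_tensor: "\<exists>t\<in>tensor_square scale. \<forall>x y. t (B x) (B y) = B y (T x + x)"
proof -
  obtain Basis where fd: "finite_dimensional_vector_space scale Basis"
    using finite_dim by blast
  interpret finite_dimensional_vector_space scale Basis by (fact fd)
  have "(\<lambda>a. representation Basis a b) \<circ> T \<in> range B" for b
    using dual_space_comp[OF linear_T dual_space_coord[OF fd]] by (simp only: dual_space_eq_range)
  then have "\<forall>b. \<exists>z. \<forall>a. representation Basis (T a) b = B z a"
    by (auto simp: image_def fun_eq_iff)
  then obtain z where z: "representation Basis (T a) b = B (z b) a" for a b
    by metis
  \<comment> \<open>Here \<open>B (z b)\<close> is the coordinate of \<open>T\<close> at
    \<open>b\<close>. The minus sign absorbs skewness, so the pairing becomes the expansion of
    \<open>B x (T y)\<close> in the basis.\<close>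
  define t where "t = (\<Sum>b\<in>Basis. tensor2 scale b (- z b))"
  have "t (B x) (B y) = B y (T x + x)" for x y
  proof -
    have "t (B x) (B y) = (\<Sum>b\<in>Basis. tensor2 scale b (- z b) (B x) (B y))"
      unfolding t_def by (rule sum_apply2)
    also have "\<dots> = (\<Sum>b\<in>Basis. representation Basis (T y) b * B x b)"
      using form_skew[of y "z b" for b] by (simp add: form_dual z mult.commute)
    also have "\<dots> = B x (T y)"
      by (rule dual_expansion[OF fd form_dual(1), symmetric])
    finally show ?thesis by (simp add: form_T_comm)
  qed
  moreover have "t \<in> tensor_square scale"
    unfolding t_def by (rule sum_tensor2_mem[OF finite_Basis])
  ultimately show ?thesis by blast
qed

end

locale skew_adjoint_tensor = skew_adjoint_operator scale mult B T
  for scale :: "'k::field_char_0 \<Rightarrow> 'a::ab_group_add \<Rightarrow> 'a" and mult (infixl "\<cdot>" 70) and B T +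
  fixes r :: "('k, 'a) tens2"
  assumes r_mem: "r \<in> tensor_square scale"
    and r_form: "r (B x) (B y) = B y (T x + x)"
begin

lemma sharp_r: "sharp scale r (B x) = T x + x"
  and sharp_flip2_r: "sharp scale (flip2 r) (B x) = T x"
  by (rule sharp_eqI[OF vector_space_axioms], elim dual_space_cases,
      simp add: r_form flip2_def form_T_comm)+

lemma sharp_diff_r: "sharp_diff scale r (B x) = x"
  by (simp add: sharp_diff_def sharp_r sharp_flip2_r)

text \<open>By \<open>sharp_diff_r\<close> this map inverts the linear bijection \<open>B\<close>
  onto the dual.\<close>

lemma dual_linear_iso_sharp_diff: "dual_linear_iso scale (sharp_diff scale r)"
proof -
  have "\<xi> + \<eta> = B (x + y)" "(\<lambda>a. c * \<xi> a) = B (scale c x)" if "\<xi> = B x" "\<eta> = B y" for \<xi> \<eta> x y c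
    using that by (auto simp: fun_eq_iff)
  then have "\<forall>\<xi>\<in>dual_space scale. \<forall>\<eta>\<in>dual_space scale.
      sharp_diff scale r (\<xi> + \<eta>) = sharp_diff scale r \<xi> + sharp_diff scale r \<eta>"
    "\<forall>c. \<forall>\<xi>\<in>dual_space scale. sharp_diff scale r (\<lambda>a. c * \<xi> a) = scale c (sharp_diff scale r \<xi>)"
    by (metis dual_space_cases sharp_diff_r)+
  moreover have "bij_betw (sharp_diff scale r) (dual_space scale) UNIV"
    by (rule bij_betw_byWitness[where f' = B]) (auto simp: dual_space_eq_range sharp_diff_r)
  ultimately show ?thesis by (simp add: dual_linear_iso_def)
qed

section \<open>Invariance and the Yang--Baxter equation\<close>

text \<open>The tensor \<open>r - flip2 r\<close> takes the value \<open>B y x\<close> at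
  \<open>B x\<close> and \<open>B y\<close>, so its invariance is \<open>form_rmul\<close>.\<close>

lemma invariant_tensor_r: "invariant_tensor scale (\<cdot>) (r - flip2 r)"
  unfolding invariant_tensor_def
proof (intro allI ext)
  fix a and \<xi> \<eta> :: "'a \<Rightarrow> 'k"
  have d: "(r - flip2 r) (B x) (B y) = B y x" for x y
    by (simp add: flip2_def r_form form_T_swap[of y x] form_skew[of x y])
  show "(tensor_map scale (rmul (\<cdot>) a - lmul (\<cdot>) a) id (r - flip2 r)
      + tensor_map scale id (rmul (\<cdot>) a) (r - flip2 r)) \<xi> \<eta> = 0 \<xi> \<eta>"
  proof (cases "\<xi> \<in> dual_space scale \<and> \<eta> \<in> dual_space scale")
    case True
    then obtain x y where eq: "\<xi> = B x" "\<eta> = B y" by (metis dual_space_cases)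
    have "(tensor_map scale (rmul (\<cdot>) a - lmul (\<cdot>) a) id (r - flip2 r)
        + tensor_map scale id (rmul (\<cdot>) a) (r - flip2 r)) \<xi> \<eta>
      = (r - flip2 r) (B (- (x \<cdot> a))) (B y) + (r - flip2 r) (B x) (B (a \<cdot> y - y \<cdot> a))"
      unfolding eq by (simp add: tensor_map_def restrict2_def form_dual form_comp_rmul_minus_lmul
          form_comp_rmul del: form_simps minus_apply)
    then show ?thesis
      unfolding d form_rmul[of y x a, symmetric] by simp
  qed (auto simp: tensor_map_def restrict2_def)
qed

text \<open>The left side is the Yang--Baxter tensor at \<open>B x\<close>, \<open>B y\<close>,
  \<open>B z\<close>, see \<open>aybe_sum_apply\<close>. Moving \<open>T\<close> off
  \<open>z\<close> replaces it by its adjoint \<open>- T - id\<close>; the terms without an outer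
  \<open>T\<close> cancel against the expansion of the last product.\<close>

lemma YBE_form:
  "B x (T y \<cdot> T z) + B y ((T x + x) \<cdot> T z) - B y (T z \<cdot> (T x + x)) - B z ((T y + y) \<cdot> (T x + x))
    = B (T y \<cdot> T x - T (T y \<cdot> x + y \<cdot> T x + y \<cdot> x)) z"
proof -
  have 1: "B x (T y \<cdot> T z) = - B (T (T y \<cdot> x)) z - B (T y \<cdot> x) z" for x
    using form_T[of "T y \<cdot> x" z] by (simp add: form_lmul)
  have 2: "B y (u \<cdot> T z) - B y (T z \<cdot> u) = - B (T (y \<cdot> u)) z - B (y \<cdot> u) z" for u
    using form_T[of "y \<cdot> u" z] form_invariant[of y u "T z"] by simp
  have 3: "B z u = - B u z" for u by (rule form_skew)
  show ?thesis
    using 2[of x] 2[of "T x"] by (simp add: 1 3[of "_ \<cdot> _"] algebra_simps)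
qed

text \<open>By \<open>YBE_form\<close> the Yang--Baxter tensor pairs \<open>z\<close> with the
  failure of the Rota--Baxter identity, which nondegeneracy of \<open>B\<close> detects.\<close>

lemma YBE_iff:
  "anti_leibniz_YBE scale (\<cdot>) r \<longleftrightarrow> (\<forall>x y. T x \<cdot> T y = T (T x \<cdot> y + x \<cdot> T y + x \<cdot> y))"
proof -
  have A: "anti_leibniz_algebra scale (\<cdot>)" by (fact anti_leibniz_algebra_axioms)
  have apply_form: "aybe_sum scale (\<cdot>) xs (B x) (B y) (B z) =
      B (T y \<cdot> T x - T (T y \<cdot> x + y \<cdot> T x + y \<cdot> x)) z"
    if xs: "r = (\<Sum>(x, y)\<leftarrow>xs. tensor2 scale x y)" for xs x y z
    unfolding aybe_sum_apply[OF A xs form_dual(1) form_dual(1) form_dual(1)] sharp_r sharp_flip2_r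
    by (rule YBE_form)
  show ?thesis
  proof
    assume Y: "anti_leibniz_YBE scale (\<cdot>) r"
    obtain xs where xs: "r = (\<Sum>(x, y)\<leftarrow>xs. tensor2 scale x y)"
      using r_mem unfolding tensor_square_def by blast
    then have 0: "aybe_sum scale (\<cdot>) xs = 0"
      using Y unfolding anti_leibniz_YBE_def by blast
    have "B (T y \<cdot> T x - T (T y \<cdot> x + y \<cdot> T x + y \<cdot> x)) z = 0" for x y z
      unfolding apply_form[OF xs, symmetric] 0 by simp
    then have "T y \<cdot> T x - T (T y \<cdot> x + y \<cdot> T x + y \<cdot> x) = 0" for x y
      using nondegenerate unfolding nondegenerate_def by blast
    then show "\<forall>x y. T x \<cdot> T y = T (T x \<cdot> y + x \<cdot> T y + x \<cdot> y)"
      by (metis eq_iff_diff_eq_0)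
  next
    assume RB: "\<forall>x y. T x \<cdot> T y = T (T x \<cdot> y + x \<cdot> T y + x \<cdot> y)"
    have "aybe_sum scale (\<cdot>) xs \<xi> \<eta> \<zeta> = 0"
      if xs: "r = (\<Sum>(x, y)\<leftarrow>xs. tensor2 scale x y)" for xs \<xi> \<eta> \<zeta>
    proof (cases "\<xi> \<in> dual_space scale \<and> \<eta> \<in> dual_space scale \<and> \<zeta> \<in> dual_space scale")
      case True
      then obtain x y z where "\<xi> = B x" "\<eta> = B y" "\<zeta> = B z" by (metis dual_space_cases)
      then show ?thesis
        unfolding apply_form[OF xs, of x y z, folded \<open>\<xi> = B x\<close> \<open>\<eta> = B y\<close> \<open>\<zeta> = B z\<close>] RB[rule_format, of y x]
        by simp
    next
      case False
      then show ?thesis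
        by (auto simp: aybe_sum_def sum_list_apply3 split_def tensor3_def restrict3_def)
    qed
    then show "anti_leibniz_YBE scale (\<cdot>) r"
      using r_mem by (auto simp: anti_leibniz_YBE_def fun_eq_iff)
  qed
qed

section \<open>The coproduct of \<open>r\<close> and its dual product\<close>

text \<open>For a Rota--Baxter operator \<open>T\<close> of weight one this is the descendent
  product.\<close>

definition dual_mult :: "'a \<Rightarrow> 'a \<Rightarrow> 'a" (infixl "\<diamondop>" 70) where
  "x \<diamondop> y = x \<cdot> T y + T x \<cdot> y + x \<cdot> y"

text \<open>The first summand of the coboundary yields \<open>x \<cdot> T y\<close> through the
  adjunction, the second yields \<open>(T x + x) \<cdot> y\<close>.\<close>

lemma coboundary_form: "coboundary scale (\<cdot>) r a (B x) (B y) = B (x \<diamondop> y) a"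
proof -
  have "coboundary scale (\<cdot>) r a (B x) (B y) = B y (T (- (x \<cdot> a)) + - (x \<cdot> a)) + B (a \<cdot> y - y \<cdot> a) (T x + x)"
    by (simp add: coboundary_def tensor_map_def restrict2_def form_dual form_comp_rmul_minus_lmul
        form_comp_rmul r_form del: T_simps form_simps)
  also have "B y (T (- (x \<cdot> a)) + - (x \<cdot> a)) = B (x \<cdot> T y) a"
    by (simp add: form_T_swap[of y "x \<cdot> a"] form_swap_right[of x "T y" a])
  also have "B (a \<cdot> y - y \<cdot> a) (T x + x) = B (T x \<cdot> y + x \<cdot> y) a"
    using form_rmul[of y "T x + x" a] form_skew[of y "(T x + x) \<cdot> a"]
      form_swap_right[of "T x" a y] form_swap_right[of x a y] by simp
  finally show ?thesis by (simp add: dual_mult_def algebra_simps)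
qed

lemma coboundary_outside_dual:
  "\<xi> \<notin> dual_space scale \<or> \<eta> \<notin> dual_space scale \<Longrightarrow> coboundary scale (\<cdot>) r a \<xi> \<eta> = 0"
  by (auto simp: coboundary_def tensor_map_def restrict2_def)

lemma coboundary_mem: "coboundary scale (\<cdot>) r a \<in> tensor_square scale"
  unfolding coboundary_def
  by (intro tensor_square_add tensor_map_mem r_mem linear_rmul linear_rmul_minus_lmul)
    (use linear_id in \<open>simp_all add: id_def\<close>)

lemma linear_coboundary: "Vector_Spaces.linear scale tens2_scale (coboundary scale (\<cdot>) r)"
proof -
  have VT: "vector_space (tens2_scale :: 'k \<Rightarrow> ('k, 'a) tens2 \<Rightarrow> _)"
    by unfold_locales (simp_all add: tens2_scale_def fun_eq_iff algebra_simps)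
  have "coboundary scale (\<cdot>) r (a + b) \<xi> \<eta> = (coboundary scale (\<cdot>) r a + coboundary scale (\<cdot>) r b) \<xi> \<eta> \<and>
      coboundary scale (\<cdot>) r (scale c a) \<xi> \<eta> = tens2_scale c (coboundary scale (\<cdot>) r a) \<xi> \<eta>" for a b c \<xi> \<eta>
  proof (cases "\<xi> \<in> dual_space scale \<and> \<eta> \<in> dual_space scale")
    case True
    then obtain x y where "\<xi> = B x" "\<eta> = B y" by (metis dual_space_cases)
    then show ?thesis by (simp add: coboundary_form tens2_scale_def)
  qed (auto simp: coboundary_outside_dual tens2_scale_def)
  then show ?thesis
    by (simp add: Vector_Spaces.linear_iff vector_space_axioms VT fun_eq_iff)
qed

text \<open>This is the first compatibility condition evaluated at \<open>B x\<close> and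
  \<open>B y\<close>.\<close>

lemma coboundary_compat_left:
  "B (x \<diamondop> y) (a1 \<cdot> a2)
    + (B (x \<diamondop> (a2 \<cdot> y - y \<cdot> a2)) a1 - B ((a2 \<cdot> y - y \<cdot> a2) \<diamondop> x) a1
      - (B ((a2 \<cdot> x - x \<cdot> a2) \<diamondop> y) a1 - B (y \<diamondop> (a2 \<cdot> x - x \<cdot> a2)) a1)
      + (B ((a2 \<cdot> x) \<diamondop> y) a1 - B (y \<diamondop> (a2 \<cdot> x)) a1))
    + (B (x \<diamondop> (a1 \<cdot> y)) a2 + B ((a1 \<cdot> x) \<diamondop> y) a2) = 0"
proof -
  \<comment> \<open>The contributions of \<open>a2 \<cdot> x\<close> cancel between the second and
    third lines and leave only those of \<open>v\<close>.\<close>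
  define u v w q where "u = a2 \<cdot> y - y \<cdot> a2" and "v = x \<cdot> a2" and "w = a1 \<cdot> y" and "q = a1 \<cdot> x"
  have comm: "B (c \<cdot> d) a - B (d \<cdot> c) a = - B c (a \<cdot> d)" for a c d
    using form_skew[of a "c \<cdot> d - d \<cdot> c"] form_invariant[of a c d] by (simp add: form_lmul)
  have left: "B (z \<cdot> y) (a1 \<cdot> a2) + (B (z \<cdot> u) a1 - B (u \<cdot> z) a1) + B (z \<cdot> w) a2 = 0" for z
  proof -
    \<comment> \<open>The vector that pairs with \<open>z\<close> is a difference of two instances
      of the anti-Leibniz identity.\<close>
    have "y \<cdot> (a1 \<cdot> a2) - (a1 \<cdot> a2) \<cdot> y - a1 \<cdot> u + (w \<cdot> a2 - a2 \<cdot> w)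
        = (a1 \<cdot> (y \<cdot> a2) + (a1 \<cdot> y) \<cdot> a2 + y \<cdot> (a1 \<cdot> a2)) - (a1 \<cdot> (a2 \<cdot> y) + (a1 \<cdot> a2) \<cdot> y + a2 \<cdot> (a1 \<cdot> y))"
      by (simp add: u_def w_def algebra_simps)
    then have "y \<cdot> (a1 \<cdot> a2) - (a1 \<cdot> a2) \<cdot> y - a1 \<cdot> u + (w \<cdot> a2 - a2 \<cdot> w) = 0"
      by (simp only: anti_leibniz) simp
    then have "B z (y \<cdot> (a1 \<cdot> a2) - (a1 \<cdot> a2) \<cdot> y - a1 \<cdot> u + (w \<cdot> a2 - a2 \<cdot> w)) = 0"
      by (simp only: form_simps)
    then show ?thesis
      unfolding comm form_invariant[of z y] form_invariant[of z w] by simp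
  qed
  have right: "B (x \<cdot> z) (a1 \<cdot> a2) + (B (v \<cdot> z) a1 - B (z \<cdot> v) a1) + B (q \<cdot> z) a2 = 0" for z
  proof -
    have "x \<cdot> (a1 \<cdot> a2) + a1 \<cdot> v + q \<cdot> a2 = 0"
      using anti_leibniz[of a1 x a2] by (simp add: v_def q_def algebra_simps)
    moreover have "B (x \<cdot> z) (a1 \<cdot> a2) + (B (v \<cdot> z) a1 - B (z \<cdot> v) a1) + B (q \<cdot> z) a2
        = - B (x \<cdot> (a1 \<cdot> a2) + a1 \<cdot> v + q \<cdot> a2) z"
      by (simp add: comm form_swap_right[of x z "a1 \<cdot> a2"] form_swap_right[of q z a2]
          form_lmul[of v a1 z] algebra_simps)
    ultimately show ?thesis by simp
  qed
  have Tu: "B (x \<cdot> T u) a1 - B (T u \<cdot> x) a1 = - B q (T u)"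
    unfolding comm q_def by (simp add: form_lmul)
  have vz: "B (z \<cdot> y) a1 - B (y \<cdot> z) a1 = - B z w" for z
    unfolding comm w_def ..
  have wz: "B (x \<cdot> z) a2 = - B v z" for z
    unfolding v_def by (rule form_swap_right)
  have qz: "B (z \<cdot> y) a2 = - B z u" for z
    by (simp add: u_def form_invariant)
  have "B (x \<diamondop> y) (a1 \<cdot> a2)
      + (B (x \<diamondop> (a2 \<cdot> y - y \<cdot> a2)) a1 - B ((a2 \<cdot> y - y \<cdot> a2) \<diamondop> x) a1
        - (B ((a2 \<cdot> x - x \<cdot> a2) \<diamondop> y) a1 - B (y \<diamondop> (a2 \<cdot> x - x \<cdot> a2)) a1)
        + (B ((a2 \<cdot> x) \<diamondop> y) a1 - B (y \<diamondop> (a2 \<cdot> x)) a1))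
      + (B (x \<diamondop> (a1 \<cdot> y)) a2 + B ((a1 \<cdot> x) \<diamondop> y) a2)
    = B (x \<diamondop> y) (a1 \<cdot> a2) + (B (x \<diamondop> u) a1 - B (u \<diamondop> x) a1) + (B (v \<diamondop> y) a1 - B (y \<diamondop> v) a1)
      + (B (x \<diamondop> w) a2 + B (q \<diamondop> y) a2)"
    by (simp add: dual_mult_def u_def v_def w_def q_def)
  \<comment> \<open>The first three groups are \<open>left\<close> at \<open>T x\<close>,
    \<open>left\<close> at \<open>x\<close> and \<open>right\<close> at \<open>T y\<close>. In the
    rest, \<open>T u\<close> pairs with \<open>T q\<close> and \<open>T v\<close> with
    \<open>T w\<close>; both pairs vanish by the adjunction.\<close>
  also have "\<dots> =
      (B (T x \<cdot> y) (a1 \<cdot> a2) + (B (T x \<cdot> u) a1 - B (u \<cdot> T x) a1) + B (T x \<cdot> w) a2)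
      + (B (x \<cdot> y) (a1 \<cdot> a2) + (B (x \<cdot> u) a1 - B (u \<cdot> x) a1) + B (x \<cdot> w) a2)
      + (B (x \<cdot> T y) (a1 \<cdot> a2) + (B (v \<cdot> T y) a1 - B (T y \<cdot> v) a1) + B (q \<cdot> T y) a2)
      + (B (x \<cdot> T u) a1 - B (T u \<cdot> x) a1) + B (T q \<cdot> y) a2 + B (q \<cdot> y) a2
      + (B (T v \<cdot> y) a1 - B (y \<cdot> T v) a1) + (B (v \<cdot> y) a1 - B (y \<cdot> v) a1) + B (x \<cdot> T w) a2"
    by (simp add: dual_mult_def algebra_simps)
  also have "\<dots> = 0"
    unfolding left right unfolding Tu vz wz qz form_T by simp
  finally show ?thesis .
qed

text \<open>This is the second compatibility condition at \<open>B x\<close> and \<open>B y\<close>.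
  Left multiplication by a commutator is zero, so each side keeps only its term with
  \<open>T\<close> on the commutator. It remains to see that \<open>B (T p) u\<close> is symmetric
  in \<open>p\<close> and \<open>u\<close>, which is the adjunction once
  \<open>B p u = 0\<close>.\<close>

lemma coboundary_compat_right: "B ((a1 \<cdot> x - x \<cdot> a1) \<diamondop> y) a2 = B ((a2 \<cdot> y - y \<cdot> a2) \<diamondop> x) a1"
proof -
  define p u where "p = a1 \<cdot> x - x \<cdot> a1" and "u = a2 \<cdot> y - y \<cdot> a2"
  have p: "p \<cdot> z = 0" and u: "u \<cdot> z = 0" for z
    using mult_swap[of a1 x z] mult_swap[of a2 y z] by (simp_all add: p_def u_def)
  have "B (T p \<cdot> y) a2 = - B (T p) u" "B (T u \<cdot> x) a1 = - B (T u) p"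
    by (simp_all add: p_def u_def form_invariant)
  moreover have "B p u = 0"
    using form_invariant[of p a2 y] by (simp add: p u_def)
  ultimately show ?thesis
    using form_T[of p u] form_skew[of p u] form_skew[of p "T u"]
    unfolding p_def[symmetric] u_def[symmetric]
    by (simp add: dual_mult_def p u)
qed

lemma bialgebra_coboundary:
  assumes RB: "\<And>x y. T x \<cdot> T y = T (T x \<cdot> y + x \<cdot> T y + x \<cdot> y)"
  shows "anti_leibniz_bialgebra scale (\<cdot>) (coboundary scale (\<cdot>) r)"
proof -
  let ?D = "coboundary scale (\<cdot>) r"
  have T_dual_mult: "T (x \<diamondop> y) = T x \<cdot> T y" for x y
    unfolding RB dual_mult_def by (simp add: algebra_simps)
  have dual_mult_anti_leibniz: "(x \<diamondop> y) \<diamondop> z + x \<diamondop> (y \<diamondop> z) + y \<diamondop> (x \<diamondop> z) = 0" for x y z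
  proof -
    have "x \<diamondop> (y \<diamondop> z) = x \<cdot> (T y \<cdot> T z) + (T x + x) \<cdot> (y \<diamondop> z)" for x y z
      by (simp add: dual_mult_def[of x "y \<diamondop> z"] T_dual_mult algebra_simps)
    moreover have "(x \<diamondop> y) \<diamondop> z = (x \<diamondop> y) \<cdot> (T z + z) + (T x \<cdot> T y) \<cdot> z"
      by (simp add: dual_mult_def[of "x \<diamondop> y" z] T_dual_mult algebra_simps)
    \<comment> \<open>There is one anti-Leibniz instance for each choice of arguments under
      \<open>T\<close> except all three. Fixing the left factor in \<open>mult_right_assoc\<close>
      prevents the rule from exchanging factors forever.\<close>
    ultimately show ?thesis
      unfolding dual_mult_def
      using anti_leibniz[of x "T y" "T z"] anti_leibniz[of "T x" y "T z"] anti_leibniz[of x y "T z"]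
        anti_leibniz[of "T x" "T y" z] anti_leibniz[of x "T y" z] anti_leibniz[of "T x" y z]
        anti_leibniz[of x y z]
      by (simp add: mult_right_assoc[of x] mult_right_assoc[of "T x"] algebra_simps)
  qed
  \<comment> \<open>Substituting this functional turns the coproduct axiom at \<open>B x\<close>,
    \<open>B y\<close>, \<open>B z\<close> into the anti-Leibniz identity of
    \<open>\<diamondop>\<close>, paired with \<open>a\<close>.\<close>
  have D_dual: "(\<lambda>b. ?D b (B x) (B y)) = B (x \<diamondop> y)" for x y
    by (simp add: coboundary_form)
  have coassoc: "(comult_id scale ?D (?D a) + id_comult scale ?D (?D a)
      + flip12 (id_comult scale ?D (?D a))) \<xi> \<eta> \<zeta> = 0" for a \<xi> \<eta> \<zeta>
  proof (cases "\<xi> \<in> dual_space scale \<and> \<eta> \<in> dual_space scale \<and> \<zeta> \<in> dual_space scale")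
    case True
    then obtain x y z where eq: "\<xi> = B x" "\<eta> = B y" "\<zeta> = B z" by (metis dual_space_cases)
    have "B ((x \<diamondop> y) \<diamondop> z + x \<diamondop> (y \<diamondop> z) + y \<diamondop> (x \<diamondop> z)) a = 0"
      unfolding dual_mult_anti_leibniz by simp
    then show ?thesis
      unfolding eq
      by (simp add: comult_id_def id_comult_def flip12_def restrict3_def form_dual D_dual coboundary_form)
  qed (auto simp: comult_id_def id_comult_def flip12_def restrict3_def)
  have compat_left: "(?D (a1 \<cdot> a2)
      + (let D = ?D a1 - flip2 (?D a1) in
           tensor_map scale id (rmul (\<cdot>) a2) D - tensor_map scale (rmul (\<cdot>) a2) id D
           + tensor_map scale (lmul (\<cdot>) a2) id D)
      + (tensor_map scale id (lmul (\<cdot>) a1) (?D a2) + tensor_map scale (lmul (\<cdot>) a1) id (?D a2))) \<xi> \<eta> = 0"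
    for a1 a2 \<xi> \<eta>
  proof (cases "\<xi> \<in> dual_space scale \<and> \<eta> \<in> dual_space scale")
    case True
    then obtain x y where eq: "\<xi> = B x" "\<eta> = B y" by (metis dual_space_cases)
    show ?thesis
      unfolding eq using coboundary_compat_left[of x y a1 a2]
      by (simp add: Let_def tensor_map_def restrict2_def form_dual form_comp_rmul form_comp_lmul
          coboundary_form flip2_def del: form_simps)
  qed (auto simp: Let_def tensor_map_def restrict2_def coboundary_outside_dual)
  have compat_right: "(tensor_map scale (rmul (\<cdot>) a1) id (?D a2)
      - flip2 (tensor_map scale (rmul (\<cdot>) a2) id (?D a1))) \<xi> \<eta> = 0" for a1 a2 \<xi> \<eta>
  proof (cases "\<xi> \<in> dual_space scale \<and> \<eta> \<in> dual_space scale")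
    case True
    then obtain x y where eq: "\<xi> = B x" "\<eta> = B y" by (metis dual_space_cases)
    show ?thesis
      unfolding eq using coboundary_compat_right[of a1 x y a2]
      by (simp add: tensor_map_def restrict2_def form_dual form_comp_rmul coboundary_form flip2_def
          del: form_simps)
  qed (auto simp: tensor_map_def restrict2_def flip2_def)
  show ?thesis
    unfolding anti_leibniz_bialgebra_def
    using anti_leibniz_algebra_axioms coboundary_mem linear_coboundary coassoc compat_left compat_right
    by (auto simp: fun_eq_iff simp del: plus_fun_apply minus_apply)
qed

lemma factorizable_r:
  assumes "\<And>x y. T x \<cdot> T y = T (T x \<cdot> y + x \<cdot> T y + x \<cdot> y)"
  shows "factorizable scale (\<cdot>) r"
proof -
  have "anti_leibniz_YBE scale (\<cdot>) r"
    unfolding YBE_iff using assms by blast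
  then show ?thesis
    using invariant_tensor_r bialgebra_coboundary[OF assms] dual_linear_iso_sharp_diff
    by (simp add: factorizable_def quasi_triangular_def)
qed

end

section \<open>Factorizable bialgebras and Rota--Baxter operators\<close>

text \<open>The data are brought into \<open>skew_adjoint_tensor\<close>, where
  \<open>YBE_iff\<close> gives weight one for \<open>T\<close>. Multiplying \<open>T\<close> by
  \<open>lam\<close> then gives weight \<open>lam\<close>, including \<open>lam = 0\<close>.\<close>

lemma factorizable_imp_skew_quadratic_RB:
  assumes A: "anti_leibniz_algebra s m" and r: "r \<in> tensor_square s" and F: "factorizable s m r"
  defines "B \<equiv> inv_into (dual_space s) (sharp_diff s r)"
  shows "skew_quadratic_RB s m B (\<lambda>a. s lam (sharp s (flip2 r) (B a))) lam"
proof -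
  interpret anti_leibniz_algebra s m by (fact A)
  define I Q where "I = sharp_diff s r" and "Q = sharp s (flip2 r)"
  have iso: "dual_linear_iso s I" and inv: "invariant_tensor s m (r - flip2 r)"
    and YBE: "anti_leibniz_YBE s m r"
    using F by (simp_all add: factorizable_def quasi_triangular_def I_def)
  have bij: "bij_betw I (dual_space s) UNIV" using iso by (simp add: dual_linear_iso_def)
  have B_dual: "B a \<in> dual_space s" and IB: "I (B a) = a" for a
    using bij_betw_imp_surj_on[OF bij] inv_into_into[of a I "dual_space s"]
      f_inv_into_f[of a I "dual_space s"] by (simp_all add: B_def I_def)
  have BI: "B (I \<xi>) = \<xi>" if "\<xi> \<in> dual_space s" for \<xi>
    using bij_betw_inv_into_left[OF bij that] by (simp add: B_def I_def)
  have B_add: "B (a + b) = B a + B b" and B_scale: "B (s c a) = (\<lambda>x. c * B a x)" for a b c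
    using iso BI[of "B a + B b"] BI[of "\<lambda>x. c * B a x"] B_dual IB
      dual_space_add_scale[OF vector_space_axioms B_dual B_dual]
    unfolding dual_linear_iso_def by metis+
  have Q: "\<eta> (Q \<xi>) = r \<eta> \<xi>" if "\<xi> \<in> dual_space s" "\<eta> \<in> dual_space s" for \<xi> \<eta>
    using sharp_apply[OF vector_space_axioms tensor_square_flip2[OF r] that]
    by (simp add: Q_def flip2_def)
  have diff: "r \<xi> \<eta> - r \<eta> \<xi> = \<eta> (I \<xi>)" if "\<xi> \<in> dual_space s" "\<eta> \<in> dual_space s" for \<xi> \<eta>
    using sharp_apply[OF vector_space_axioms r that] Q[OF that] dual_spaceD(2)[OF that(2)]
    by (simp add: I_def sharp_diff_def Q_def)
  \<comment> \<open>Thus \<open>B\<close> is an antisymmetrisation of \<open>r\<close> read through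
    the inverse of \<open>I\<close>, and skewness is immediate.\<close>
  have form: "B y x = r (B x) (B y) - r (B y) (B x)" for x y
    using diff[OF B_dual B_dual, of x y] by (simp add: IB)
  have bilinear: "bilinear_form s B"
    using B_dual by (auto simp: bilinear_form_def dual_space_def Vector_Spaces.linear_iff B_add B_scale)
  have skew: "B x y = - B y x" for x y
    using form[of x y] form[of y x] by simp
  have nondegenerate: "nondegenerate B"
  proof -
    have "a = 0" if "\<And>b. B a b = 0" for a
    proof -
      have "B a = B 0" using that B_scale[of 0 0] by (simp add: fun_eq_iff)
      then show ?thesis using IB by metis
    qed
    moreover have "B b a = 0 \<longleftrightarrow> B a b = 0" for a b
      using skew[of a b] by simp
    ultimately show ?thesis unfolding nondegenerate_def by metis
  qed
  have invariant: "B (m x a) y = B x (m a y - m y a)" for x a y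
  proof -
    have comp: "B x \<circ> (rmul m a - lmul m a) \<in> dual_space s" "B y \<circ> rmul m a \<in> dual_space s"
      using dual_space_comp linear_rmul_minus_lmul linear_rmul B_dual by blast+
    have "(tensor_map s (rmul m a - lmul m a) id (r - flip2 r)
        + tensor_map s id (rmul m a) (r - flip2 r)) (B x) (B y) = 0"
      using inv unfolding invariant_tensor_def by simp
    \<comment> \<open>The first difference is reversed so that \<open>B y\<close> comes first and
      \<open>diff\<close> evaluates the composed functional at \<open>I (B y) = y\<close>.\<close>
    then have "- (r (B y) (B x \<circ> (rmul m a - lmul m a)) - r (B x \<circ> (rmul m a - lmul m a)) (B y))
        + (r (B x) (B y \<circ> rmul m a) - r (B y \<circ> rmul m a) (B x)) = 0"
      using B_dual by (simp add: tensor_map_def restrict2_def flip2_def)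
    then have "B y (m x a) = B x (m y a - m a y)"
      unfolding diff[OF B_dual comp(1)] diff[OF B_dual comp(2)] IB
      by (simp add: rmul_def lmul_def)
    then show ?thesis
      using skew[of "m x a" y] by (simp add: dual_spaceD(2)[OF B_dual])
  qed
  define T where "T x = Q (B x)" for x
  have lin: "Vector_Spaces.linear s s T"
    using sharp_linear[OF vector_space_axioms tensor_square_flip2[OF r] B_dual B_dual]
    by (simp add: Vector_Spaces.linear_iff vector_space_axioms T_def Q_def B_add B_scale)
  have adj: "B (T x) y + B x (T y) + B x y = 0" for x y
    using skew[of "T x" y] by (simp add: T_def Q B_dual form[of x y])
  have form_r: "r (B x) (B y) = B y (T x + x)" for x y
    by (simp add: dual_spaceD(1)[OF B_dual] T_def Q B_dual form[of y x])
  have skew_symmetric: "skew_symmetric B" and invariant_form: "invariant_form m B"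
    unfolding skew_symmetric_def invariant_form_def using skew invariant by blast+
  interpret skew_adjoint_tensor s m B T r
    by (intro skew_adjoint_tensor.intro skew_adjoint_tensor_axioms.intro
        skew_adjoint_operator.intro skew_adjoint_operator_axioms.intro
        skew_quadratic_anti_leibniz_algebra.intro skew_quadratic_anti_leibniz_algebra_axioms.intro
        A bilinear nondegenerate skew_symmetric invariant_form lin adj r form_r)
  have RB: "m (T x) (T y) = T (m (T x) y + m x (T y) + m x y)" for x y
    using YBE unfolding YBE_iff by blast
  have "Vector_Spaces.linear s s (\<lambda>a. s lam (T a))"
    by (simp add: Vector_Spaces.linear_iff vector_space_axioms scale_right_distrib mult.commute)
  moreover have "m (s lam (T x)) (s lam (T y))
      = s lam (T (m (s lam (T x)) y + m x (s lam (T y)) + s lam (m x y)))" for x y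
    using RB[of x y] by (simp add: scale_right_distrib)
  moreover have "B (s lam (T x)) y + B x (s lam (T y)) + lam * B x y = 0" for x y
  proof -
    have "B (s lam (T x)) y + B x (s lam (T y)) + lam * B x y = lam * (B (T x) y + B x (T y) + B x y)"
      by (simp add: algebra_simps)
    then show ?thesis by (simp add: adjoint)
  qed
  ultimately show ?thesis
    using A bilinear nondegenerate skew_symmetric invariant_form
    unfolding skew_quadratic_RB_def rota_baxter_def T_def Q_def by blast
qed

text \<open>Dividing \<open>R\<close> by \<open>lam\<close> gives an operator \<open>T\<close> of
  weight one with \<open>P (B x) = T x + x\<close>, which is the situation of
  \<open>skew_adjoint_tensor\<close>.\<close>

lemma skew_quadratic_RB_imp_factorizable:
  assumes RB: "skew_quadratic_RB s m B R lam" and lam: "lam \<noteq> 0"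
  defines "P \<equiv> \<lambda>\<xi>. s (1 / lam) (R (form_iso B \<xi>) + s lam (form_iso B \<xi>))"
  shows "\<exists>!r. r \<in> tensor_square s \<and> (\<forall>\<xi>\<in>dual_space s. \<forall>\<eta>\<in>dual_space s. \<eta> (P \<xi>) = r \<xi> \<eta>)"
    and "\<lbrakk>r \<in> tensor_square s; \<forall>\<xi>\<in>dual_space s. \<forall>\<eta>\<in>dual_space s. \<eta> (P \<xi>) = r \<xi> \<eta>\<rbrakk>
      \<Longrightarrow> factorizable s m r"
proof -
  have R: "Vector_Spaces.linear s s R"
    and R_mult: "m (R x) (R y) = R (m (R x) y + m x (R y) + s lam (m x y))"
    and R_form: "B (R x) y + B x (R y) + lam * B x y = 0" for x y
    using RB unfolding skew_quadratic_RB_def rota_baxter_def by blast+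
  interpret skew_quadratic_anti_leibniz_algebra s m B
    using RB unfolding skew_quadratic_RB_def
    by (simp add: skew_quadratic_anti_leibniz_algebra_def skew_quadratic_anti_leibniz_algebra_axioms_def)
  interpret R: Vector_Spaces.linear s s R by (fact R)
  define T where "T x = s (1 / lam) (R x)" for x
  have R_T: "R x = s lam (T x)" for x using lam by (simp add: T_def)
  have "Vector_Spaces.linear s s T"
    by (simp add: Vector_Spaces.linear_iff vector_space_axioms T_def R.add R.scale
        scale_right_distrib mult.commute)
  moreover have "B (T x) y + B x (T y) + B x y = 0" for x y
  proof -
    have "lam * (B (T x) y + B x (T y) + B x y) = 0"
      using R_form[of x y] unfolding R_T by (simp add: algebra_simps)
    then show ?thesis using lam by simp
  qed
  ultimately interpret skew_adjoint_operator s m B T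
    by (intro skew_adjoint_operator.intro skew_adjoint_operator_axioms.intro
        skew_quadratic_anti_leibniz_algebra_axioms)
  have T_mult: "m (T x) (T y) = T (m (T x) y + m x (T y) + m x y)" for x y
  proof -
    \<comment> \<open>Every term, including the weight term, carries the factor
      \<open>lam * lam\<close>.\<close>
    have "s (lam * lam) (m (T x) (T y)) = s (lam * lam) (T (m (T x) y + m x (T y) + m x y))"
      using R_mult[of x y] unfolding R_T by (simp add: scale_right_distrib)
    then show ?thesis using lam by simp
  qed
  have inj: "inj B"
    using form_ext by (intro injI) metis
  have P: "P (B x) = T x + x" for x
    using lam by (simp add: P_def form_iso_def inv_f_f[OF inj] T_def scale_right_distrib)
  have char: "(\<forall>\<xi>\<in>dual_space s. \<forall>\<eta>\<in>dual_space s. \<eta> (P \<xi>) = r \<xi> \<eta>) \<longleftrightarrow>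
      (\<forall>x y. r (B x) (B y) = B y (T x + x))" for r
    unfolding dual_space_eq_range by (auto simp: P simp del: form_simps)
  have uniq: "r = t"
    if "r \<in> tensor_square s" "\<forall>x y. r (B x) (B y) = B y (T x + x)"
      "t \<in> tensor_square s" "\<forall>x y. t (B x) (B y) = B y (T x + x)" for r t
  proof (intro ext)
    fix \<xi> \<eta>
    \<comment> \<open>On the dual every functional is some \<open>B x\<close>; elsewhere both
      tensors have the default value 0.\<close>
    show "r \<xi> \<eta> = t \<xi> \<eta>"
      using that tensor_square_outside_dual[of _ s \<xi> \<eta>] dual_space_cases[of \<xi>] dual_space_cases[of \<eta>]
      by metis
  qed
  show "\<exists>!r. r \<in> tensor_square s \<and> (\<forall>\<xi>\<in>dual_space s. \<forall>\<eta>\<in>dual_space s. \<eta> (P \<xi>) = r \<xi> \<eta>)"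
    unfolding char using ex_tensor uniq by blast
  assume "r \<in> tensor_square s" "\<forall>\<xi>\<in>dual_space s. \<forall>\<eta>\<in>dual_space s. \<eta> (P \<xi>) = r \<xi> \<eta>"
  then interpret skew_adjoint_tensor s m B T r
    unfolding char by unfold_locales auto
  show "factorizable s m r"
    using T_mult by (rule factorizable_r)
qed

text \<open>In the converse, \<open>r\<close> is given by its pairings; unique existence shows that
  they do define a tensor.\<close>

theorem theorem3p30:
  fixes s :: "'k::field_char_0 \<Rightarrow> 'a::ab_group_add \<Rightarrow> 'a"
    and m :: "'a \<Rightarrow> 'a \<Rightarrow> 'a"
  assumes "anti_leibniz_algebra s m"
  shows
    "(\<forall>r lam. r \<in> tensor_square s \<longrightarrow> factorizable s m r \<longrightarrow>
        (let Iinv = inv_into (dual_space s) (sharp_diff s r)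
         in skew_quadratic_RB s m
              (\<lambda>a1 a2. (Iinv a1) a2)
              (\<lambda>a. s lam (sharp s (flip2 r) (Iinv a)))
              lam)) \<and>
     (\<forall>B R lam. skew_quadratic_RB s m B R lam \<longrightarrow> lam \<noteq> 0 \<longrightarrow>
        (let P = (\<lambda>\<xi>. s (1 / lam) (R (form_iso B \<xi>) + s lam (form_iso B \<xi>)));
             defines_r = (\<lambda>r. r \<in> tensor_square s \<and>
               (\<forall>\<xi>1\<in>dual_space s. \<forall>\<xi>2\<in>dual_space s. \<xi>2 (P \<xi>1) = r \<xi>1 \<xi>2))
         in (\<exists>!r. defines_r r) \<and>
            (\<forall>r. defines_r r \<longrightarrow> anti_leibniz_YBE s m r \<and> factorizable s m r)))"
proof (intro conjI allI impI)
  fix r lam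
  assume "r \<in> tensor_square s" "factorizable s m r"
  from factorizable_imp_skew_quadratic_RB[OF assms this]
  show "let Iinv = inv_into (dual_space s) (sharp_diff s r)
         in skew_quadratic_RB s m
              (\<lambda>a1 a2. (Iinv a1) a2)
              (\<lambda>a. s lam (sharp s (flip2 r) (Iinv a)))
              lam"
    by (simp add: Let_def)
next
  fix B R lam
  assume "skew_quadratic_RB s m B R lam" "lam \<noteq> 0"
  note conv = skew_quadratic_RB_imp_factorizable[OF this]
  show "let P = (\<lambda>\<xi>. s (1 / lam) (R (form_iso B \<xi>) + s lam (form_iso B \<xi>)));
             defines_r = (\<lambda>r. r \<in> tensor_square s \<and>
               (\<forall>\<xi>1\<in>dual_space s. \<forall>\<xi>2\<in>dual_space s. \<xi>2 (P \<xi>1) = r \<xi>1 \<xi>2))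
         in (\<exists>!r. defines_r r) \<and>
            (\<forall>r. defines_r r \<longrightarrow> anti_leibniz_YBE s m r \<and> factorizable s m r)"
    using conv unfolding Let_def factorizable_def quasi_triangular_def by blast
qed

end
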